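(* Let $f:\mathfrak{R}_{>0}\to\mathbb{C}$. Assume that there exists a constant $\check f_{-1}$ such that the function $z\mapsto f(z)-\frac{\check f_{-1}}{z}$ is $\mathscr{C}$-analytic. Then $f$ admits a Laurent expansion with coefficients $(\check f_n)_{n\ge-1}$. Let $h:(0,\infty)\to\mathfrak{R}_{>0}$. Suppose that $h(t)\to0$ as $t\to0$, and that there exist $\phi\in(-\frac\pi2,\frac\pi2)$ and $t_0>0$ such that $h((0,t_0))\subset\mathscr{C}_\phi$. Then, for any $\alpha\in(0,1)$ and any integer $N\ge0$, as $t\to0$, $$\sum_{m=0}^\infty f\big((m+\alpha)h(t)\big)=-\check f_{-1}\frac{\log h(t)}{h(t)}+\left(\check f_{-1}K(\alpha)+\int_0^\infty\Big(f(x)-\check f_{-1}\frac{e^{-x}}x\Big)dx\right)\frac1{h(t)}-\sum_{n=0}^N\frac{B_{n+1}(\alpha)}{n+1}\check f_n\,h(t)^n+O\big(h(t)^N\big),$$ where $K(\alpha)=-\gamma-\frac{\Gamma'}{\Gamma}(\alpha)$.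
   Context: $\mathfrak{R}_{>0}=\{z\in\mathbb{C}:\mathrm{Re}(z)>0\}$; $\gamma$ is Euler's constant, $\Gamma$ the Gamma function, $B_n(\cdot)$ the $n$-th Bernoulli polynomial, and $\log$ the principal branch of the logarithm. For $\phi\in(-\frac\pi2,\frac\pi2)$, $\mathscr{C}_\phi^*=\{z\in\mathbb{C}\setminus\{0\}:|\arg z|<\phi\}$ and $\mathscr{C}_\phi=\mathscr{C}_\phi^*\cup\{0\}$. A function $g$ is called rapidly decreasing if it is analytic on $\mathfrak{R}_{>0}$ and, for all integers $m,n\ge0$, $z^mg^{(n)}(z)\to0$ as $z\to\infty$ with $z\in\mathfrak{R}_{>0}$. A function $g$ defined on $\mathfrak{R}_{>0}\cup\{0\}$ is called $\mathscr{C}$-analytic if $g$ is rapidly decreasing and $g$ admits an absolutely convergent power series expansion $g(z)=\sum_{n\ge0}\check g_nz^n$ near $0$ (and hence is analytic on an open set $\mathscr{C}_\phi\cup B(0,\rho)$ for all $\phi\in(-\frac\pi2,\frac\pi2)$ and some $\rho>0$, where $B(0,\rho)$ is the open disc of radius $\rho$ centred at $0$). The Laurent expansion of $f$ is $f(z)=\sum_{n\ge-1}\check f_nz^n$ near $0$.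
   Formalization: For nonzero residue c the sum and integral diverge if f(z)-c/z is rapidly decreasing (e.g. f=1/z); instead it is assumed that f(z)-c e^{-z}/z is C-analytic, or that f is rapidly decreasing and f(z)-c/z has a power series at 0. For c=0 the hypothesis is unchanged. *)

theory Defs
  imports "HOL-Real_Asymp.Real_Asymp" "HOL-Complex_Analysis.Complex_Analysis" "HOL-Library.Landau_Symbols"
begin

definition right_half_plane :: "complex set" where
  "right_half_plane = {z. Re z > 0}"

definition sector_punctured :: "real \<Rightarrow> complex set" where
  "sector_punctured \<phi> = {z. z \<noteq> 0 \<and> \<bar>Arg z\<bar> < \<phi>}"

definition sector :: "real \<Rightarrow> complex set" where
  "sector \<phi> = insert 0 (sector_punctured \<phi>)"

definition rapidly_decreasing :: "(complex \<Rightarrow> complex) \<Rightarrow> bool" where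
  "rapidly_decreasing g \<longleftrightarrow>
     g analytic_on right_half_plane \<and>
     (\<forall>m n :: nat. ((\<lambda>z. z ^ m * (deriv ^^ n) g z) \<longlongrightarrow> 0)
                     (inf at_infinity (principal right_half_plane)))"

(* Only the values of the function on the open half-plane matter here: the functions of interest,
   such as f(z) - c/z, are not given at 0 and are extended to 0 by the constant coefficient.
   A positive radius of convergence is the same as absolute convergence near 0. *)
definition has_power_series_at_0 :: "(complex \<Rightarrow> complex) \<Rightarrow> complex fps \<Rightarrow> bool" where
  "has_power_series_at_0 g G \<longleftrightarrow>
     fps_conv_radius G > 0 \<and>
     eventually (\<lambda>z. g z = eval_fps G z) (at 0 within right_half_plane)"

definition C_analytic :: "(complex \<Rightarrow> complex) \<Rightarrow> bool" where
  "C_analytic g \<longleftrightarrow> rapidly_decreasing g \<and> (\<exists>G. has_power_series_at_0 g G)"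

(* f(z) = sum over n >= -1 of F_n z^n for small z in the half-plane (f is not given elsewhere, so
   has_laurent_expansion, which needs a punctured neighbourhood, does not apply). *)
definition has_simple_laurent_at_0 :: "(complex \<Rightarrow> complex) \<Rightarrow> complex fls \<Rightarrow> bool" where
  "has_simple_laurent_at_0 f F \<longleftrightarrow>
     fls_conv_radius F > 0 \<and> (\<forall>n < -1. fls_nth F n = 0) \<and>
     eventually (\<lambda>z. f z = eval_fls F z) (at 0 within right_half_plane)"

(* Simple-pole version of C-analyticity, with residue c.  Requiring f(z) - c/z itself to be
   rapidly decreasing would give f(z) ~ c/z at infinity, and for c \<noteq> 0 neither the series of the
   f((m + \<alpha>) h) nor the integral of f(x) - c exp(-x)/x would converge (see
   C_analytic_minus_pole_not_summable below).  So the decay is asked either of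
   f(z) - c exp(-z)/z or of f itself.  Neither alternative contains the other, because exp(-z)/z
   is not rapidly decreasing on the whole half-plane; for c = 0 both say that f is C-analytic. *)
definition C_analytic_up_to_pole :: "(complex \<Rightarrow> complex) \<Rightarrow> complex \<Rightarrow> bool" where
  "C_analytic_up_to_pole f c \<longleftrightarrow>
     C_analytic (\<lambda>z. f z - c * exp (- z) / z) \<or>
     (rapidly_decreasing f \<and> (\<exists>G. has_power_series_at_0 (\<lambda>z. f z - c / z) G))"

(* B_n(x) from the generating function t exp(x t) / (exp t - 1) = sum B_n(x) t^n / n! *)
definition bernoulli_poly :: "nat \<Rightarrow> real \<Rightarrow> real" where
  "bernoulli_poly n x = fact n * fps_nth (fps_X * fps_exp x / (fps_exp 1 - 1)) n"

definition K_const :: "real \<Rightarrow> real" where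
  "K_const \<alpha> = - euler_mascheroni - deriv Gamma \<alpha> / Gamma \<alpha>"

lemma C_analytic_up_to_pole_0: "C_analytic_up_to_pole f 0 \<longleftrightarrow> C_analytic f"
  by (auto simp: C_analytic_up_to_pole_def C_analytic_def)

lemma C_analytic_minus_pole_not_summable:
  fixes f :: "complex \<Rightarrow> complex" and c h :: complex and \<alpha> :: real
  assumes "C_analytic (\<lambda>z. f z - c / z)" "c \<noteq> 0" "Re h > 0" "0 < \<alpha>"
  shows "\<not> summable (\<lambda>m. f ((of_nat m + of_real \<alpha>) * h))"
proof
  assume S: "summable (\<lambda>m. f ((of_nat m + of_real \<alpha>) * h))"
  define z where "z = (\<lambda>m::nat. (of_nat m + of_real \<alpha>) * h)"
  have S': "summable (\<lambda>m. f (z m))" using S by (simp add: z_def)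
  have h0: "h \<noteq> 0" using assms by auto
  have zeq: "z m = of_real (real m + \<alpha>) * h" for m by (simp add: z_def)
  have nz: "z m \<noteq> 0" for m
    using h0 assms(4) unfolding zeq by (simp del: of_real_add)
  have zR: "z m \<in> right_half_plane" for m
    using assms(3,4) unfolding zeq right_half_plane_def by (simp add: add_nonneg_pos)
  have nrm: "norm (z m) = (real m + \<alpha>) * norm h" for m
    using assms(4) by (simp add: zeq norm_mult del: of_real_add)
  have "filterlim (\<lambda>m. (real m + \<alpha>) * norm h) at_top sequentially"
    using h0 by real_asymp
  hence zinf: "filterlim z at_infinity sequentially"
    by (intro filterlim_norm_at_top_imp_at_infinity) (simp add: nrm)
  have lim: "((\<lambda>w. w ^ 2 * (f w - c / w)) \<longlongrightarrow> 0) (inf at_infinity (principal right_half_plane))"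
  proof -
    have "\<forall>m n :: nat. ((\<lambda>w. w ^ m * (deriv ^^ n) (\<lambda>w. f w - c / w) w) \<longlongrightarrow> 0)
            (inf at_infinity (principal right_half_plane))"
      using assms(1) unfolding C_analytic_def rapidly_decreasing_def by blast
    from this[rule_format, of 2 0] show ?thesis by simp
  qed
  have "filterlim z (inf at_infinity (principal right_half_plane)) sequentially"
    using zinf zR by (auto simp: filterlim_inf filterlim_principal)
  from filterlim_compose[OF lim this]
  have "(\<lambda>m. z m ^ 2 * (f (z m) - c / z m)) \<longlonglongrightarrow> 0" .
  hence "eventually (\<lambda>m. norm (z m ^ 2 * (f (z m) - c / z m)) < 1) sequentially"
    using order_tendstoD(2)[OF tendsto_norm_zero zero_less_one] by blast
  hence ev: "eventually (\<lambda>m. norm (f (z m) - c / z m) \<le> (1 / (norm h)\<^sup>2) * (1 / (real m)\<^sup>2)) sequentially"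
    using eventually_gt_at_top[of 0]
  proof eventually_elim
    case (elim m)
    have "norm (f (z m) - c / z m) \<le> 1 / (norm (z m))\<^sup>2"
    proof -
      have "(norm (z m))\<^sup>2 * norm (f (z m) - c / z m) \<le> 1"
        using elim(1) by (simp add: norm_mult norm_power)
      thus ?thesis
        using nz[of m] by (simp add: pos_le_divide_eq mult.commute)
    qed
    also have "\<dots> \<le> 1 / (real m * norm h)\<^sup>2"
      unfolding nrm using elim h0 assms(4)
      by (intro divide_left_mono power_mono mult_right_mono mult_pos_pos) auto
    finally show ?case by (simp add: power_mult_distrib mult.commute)
  qed
  have "summable (\<lambda>m. (1 / (norm h)\<^sup>2) * (1 / (real m)\<^sup>2))"
    using inverse_power_summable[of 2, where 'a = real]
    by (intro summable_mult) (simp add: inverse_eq_divide)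
  from summable_diff[OF S'
      summable_comparison_test_ev[OF ev this]]
  have "summable (\<lambda>m. c / z m)"
    by simp
  hence "summable (\<lambda>m. (h / c) * (c / z m))"
    by (rule summable_mult)
  moreover have "(h / c) * (c / z m) = of_real (1 / (real m + \<alpha>))" for m
    using h0 assms(2) by (simp add: zeq)
  ultimately have "summable (\<lambda>m. complex_of_real (1 / (real m + \<alpha>)))"
    by simp
  hence R: "summable (\<lambda>m. 1 / (real m + \<alpha>))"
    by (simp only: summable_complex_of_real)
  obtain k :: nat where k: "\<alpha> \<le> real k" "k > 0"
    by (metis gr0I less_eq_real_def nat_le_real_less of_nat_0 order_less_le_trans
        assms(4) real_arch_simple not_le)
  have "summable (\<lambda>m. inverse (real (m + k)))"
    using k assms(4)
    by (intro summable_comparison_test[OF _ R] exI[of _ 0])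
       (auto simp: inverse_eq_divide intro!: divide_left_mono)
  hence "summable (\<lambda>m. inverse (real m))"
    by (simp only: summable_iff_shift[of "\<lambda>m. inverse (real m)" k])
  thus False
    using not_summable_harmonic[where 'a = real] by simp
qed

end

theory Submission
  imports Defs
begin

text \<open>
  Subtract from \<open>f\<close> the model pole \<open>c * exp (- z) / z\<close>.  The remainder \<open>g\<close> extends holomorphically across 0,
  and in each of the cones \<open>acute_cone \<delta>\<close> (closed cones about the positive axis, smaller than the half-plane)
  it is \<open>O(1 / (1 + norm z)^2)\<close>; this is all the decay that the argument uses, and both alternatives in
  \<open>C_analytic_up_to_pole\<close> give it (\<open>C_analytic_up_to_pole_imp_cone_decaying\<close>).  The sum over \<open>g\<close> and
  the sum over the model pole are then expanded separately.
  
  For \<open>g\<close> the expansion is an Euler-Maclaurin formula along the ray through the complex number \<open>h\<close>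
  (\<open>shifted_sum_asymptotics\<close>).  With \<open>P\<close> the primitive of \<open>g\<close> vanishing at 0 and
  \<open>b n = B n (\<alpha>) / fact n\<close>, the defining generating function of the Bernoulli polynomials says that
  \<open>h * g (z + \<alpha> * h)\<close> and the difference over the step from \<open>z\<close> to \<open>z + h\<close> of
  \<open>\<Sum>n\<le>N+1. b n * h^n * (deriv ^^ n) P\<close> have the same Taylor polynomial at \<open>z\<close>
  (\<open>euler_maclaurin_step\<close>).  Adding these identities for \<open>z = 0, h, 2 * h, \<dots>\<close> telescopes.  The errors,
  of order \<open>norm h ^ (N+2) / (1 + m * norm h)^2\<close>, add up to \<open>O(norm h ^ (N+1))\<close>.  The only term
  surviving at infinity is the limit of \<open>P\<close>.  It is the integral of \<open>g\<close> over the positive axis, on every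
  ray, because \<open>P (m * h)\<close> and \<open>P (m * norm h)\<close> differ by at most the length \<open>O(m)\<close> of a segment times
  the supremum \<open>O(1 / m^2)\<close> of \<open>norm g\<close> on it.
  
  For the model pole the sum is \<open>S h / h\<close> with \<open>S h = (\<Sum>m. exp (- (m + \<alpha>) * h) / (m + \<alpha>))\<close>.  The
  derivative of \<open>S\<close> is a geometric series, \<open>- exp (- \<alpha> * h) / (1 - exp (- h))\<close>, again the Bernoulli
  generating function.  Integrating its Laurent series gives \<open>S\<close> up to a constant (\<open>exp_sum_asymptotics\<close>),
  with \<open>- Ln h\<close> as the integral of the term \<open>- 1 / h\<close>.  The constant is found on the positive axis:
  by Abel summation it is \<open>\<Sum>m. 1 / (m + \<alpha>) - 1 / (m + 1)\<close>, the digamma series of \<open>K_const \<alpha>\<close>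
  (\<open>exp_sum_plus_ln_tendsto\<close>).
\<close>

section \<open>Bernoulli polynomials and one Euler-Maclaurin step\<close>

text \<open>
  The generating function \<open>X * exp (\<alpha> * X) / (exp X - 1)\<close>, with its real coefficients embedded in the complex
  numbers because it is evaluated at complex steps.
\<close>

definition bernoulli_fps :: "real \<Rightarrow> complex fps" where
  "bernoulli_fps \<alpha> = Abs_fps (\<lambda>n. of_real (bernoulli_poly n \<alpha> / fact n))"

lemma bernoulli_fps_mult_exp:
  "bernoulli_fps \<alpha> * (fps_exp 1 - 1) = fps_X * fps_exp (of_real \<alpha>)"
proof (rule fps_ext)
  fix n
  have "fps_X * fps_exp \<alpha> / (fps_exp 1 - 1) * (fps_exp 1 - 1) = fps_X * fps_exp \<alpha>"
  proof (rule dvd_div_mult_self)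
    have nz: "fps_exp 1 - 1 \<noteq> (0 :: real fps)" "fps_X * fps_exp \<alpha> \<noteq> 0"
      by (auto dest!: arg_cong[where f = "\<lambda>F. fps_nth F 1"])
    have "subdegree (fps_exp 1 - 1 :: real fps) = 1" by (rule subdegreeI) auto
    moreover have "subdegree (fps_X * fps_exp \<alpha>) = 1" by (rule subdegreeI) auto
    ultimately show "fps_exp 1 - 1 dvd fps_X * fps_exp \<alpha>" using nz by (simp add: fps_dvd_iff)
  qed
  hence "fps_nth (fps_X * fps_exp \<alpha> / (fps_exp 1 - 1) * (fps_exp 1 - 1)) n =
           fps_nth (fps_X * fps_exp \<alpha>) n" by simp
  hence "complex_of_real (fps_nth (fps_X * fps_exp \<alpha> / (fps_exp 1 - 1) * (fps_exp 1 - 1)) n) =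
           of_real (fps_nth (fps_X * fps_exp \<alpha>) n)" by simp
  thus "fps_nth (bernoulli_fps \<alpha> * (fps_exp 1 - 1)) n = fps_nth (fps_X * fps_exp (of_real \<alpha>)) n"
    unfolding bernoulli_fps_def
    by (simp add: fps_mult_nth bernoulli_poly_def if_distrib[of of_real] if_distrib[of "\<lambda>f. f _"] cong: if_cong)
qed

lemma bernoulli_fps_nth_0: "fps_nth (bernoulli_fps \<alpha>) 0 = 1"
proof -
  have "fps_nth (bernoulli_fps \<alpha> * (fps_exp 1 - 1)) 1 = fps_nth (fps_X * fps_exp (of_real \<alpha>)) 1"
    by (simp only: bernoulli_fps_mult_exp)
  thus ?thesis by (simp add: fps_mult_nth)
qed

text \<open>
  Expand both \<open>p 1 (z + \<alpha> * h)\<close> and each \<open>p n (z + h) - p n z\<close> in Taylor polynomials at \<open>z\<close>, all up to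
  the derivative \<open>p (N + 1)\<close>.  By \<open>bernoulli_fps_mult_exp\<close> the coefficients of \<open>p k z * h ^ k\<close> agree on the
  two sides, so only the Taylor remainders, which all involve \<open>p (N + 2)\<close>, contribute to the bound.
  Here \<open>p 1\<close> is the function to be summed and \<open>p 0\<close> a primitive of it.
\<close>

lemma euler_maclaurin_step:
  fixes p :: "nat \<Rightarrow> complex \<Rightarrow> complex" and h z :: complex
  defines "S \<equiv> closed_segment z (z + h)"
  assumes der: "\<And>n x. x \<in> S \<Longrightarrow> n \<le> Suc N \<Longrightarrow> (p n has_field_derivative p (Suc n) x) (at x)"
  assumes bound: "\<And>x. x \<in> S \<Longrightarrow> norm (p (Suc (Suc N)) x) \<le> B"
  assumes \<alpha>: "0 \<le> \<alpha>" "\<alpha> \<le> 1"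
  shows "norm (h * p 1 (z + of_real \<alpha> * h) -
            (\<Sum>n\<le>Suc N. fps_nth (bernoulli_fps \<alpha>) n * h ^ n * (p n (z + h) - p n z)))
          \<le> (1 + (\<Sum>n\<le>Suc N. norm (fps_nth (bernoulli_fps \<alpha>) n))) * B * norm h ^ (N + 2)"
proof -
  define \<beta> where "\<beta> = fps_nth (bernoulli_fps \<alpha>)"
  define e where "e = fps_nth (fps_exp 1 - 1 :: complex fps)"
  define M where "M = Suc N"
  define r where "r = (\<lambda>n. p n (z + h) - (\<Sum>i\<le>M-n. p (n+i) z * h ^ i / fact i))"
  define r1 where "r1 = p 1 (z + of_real \<alpha> * h) - (\<Sum>i\<le>N. p (Suc i) z * (of_real \<alpha> * h) ^ i / fact i)"
  have conv: "convex S" and zS: "z \<in> S" "z + h \<in> S" unfolding S_def by auto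
  have aS: "z + of_real \<alpha> * h \<in> S" 
    unfolding S_def in_segment using \<alpha> by (intro exI[of _ \<alpha>]) (auto simp: algebra_simps scaleR_conv_of_real)
  have B0: "B \<ge> 0" using bound[OF zS(1)] norm_ge_zero order_trans by blast
  have r: "norm (r n) \<le> B * norm h ^ Suc (M - n)" if "n \<le> M" for n
  proof -
    have "norm (p (n+0) (z + h) - (\<Sum>i\<le>M-n. p (n+i) z * (z + h - z) ^ i / fact i))
            \<le> B * norm (z + h - z) ^ Suc (M - n) / fact (M - n)"
    proof (rule field_Taylor[OF conv, where f = "\<lambda>i. p (n+i)" and B = B])
      fix i x assume "x \<in> S" "i \<le> M - n"
      thus "(p (n + i) has_field_derivative p (n + Suc i) x) (at x within S)"
        using der[of x "n + i"] that by (simp add: M_def has_field_derivative_at_within)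
    qed (use that bound zS in \<open>auto simp: M_def\<close>)
    also have "\<dots> \<le> B * norm h ^ Suc (M - n) / 1"
      using B0 by (intro frac_le) auto
    finally show ?thesis by (simp add: r_def)
  qed
  have r1: "norm r1 \<le> B * norm h ^ M"
  proof -
    have "norm (p (1+0) (z + of_real \<alpha> * h) - (\<Sum>i\<le>N. p (1+i) z * (z + of_real \<alpha> * h - z) ^ i / fact i))
            \<le> B * norm (z + of_real \<alpha> * h - z) ^ Suc N / fact N"
    proof (rule field_Taylor[OF conv, where f = "\<lambda>i. p (1+i)" and B = B])
      fix i x assume "x \<in> S" "i \<le> N"
      thus "(p (1 + i) has_field_derivative p (1 + Suc i) x) (at x within S)"
        using der[of x "Suc i"] by (simp add: has_field_derivative_at_within)
    qed (use bound zS aS in auto)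
    also have "\<dots> \<le> B * norm h ^ Suc N / 1"
      using B0 \<alpha> by (intro frac_le mult_left_mono power_mono) (auto simp: norm_mult mult_left_le_one_le)
    finally show ?thesis by (simp add: r1_def M_def)
  qed
  have diff: "p n (z + h) - p n z = r n + (\<Sum>i\<le>M-n. e i * p (n+i) z * h ^ i)" for n
  proof -
    have "(\<Sum>i\<le>M-n. p (n+i) z * h ^ i / fact i) = (\<Sum>i\<le>M-n. e i * p (n+i) z * h ^ i + (if i = 0 then p n z else 0))"
      by (intro sum.cong) (auto simp: e_def field_simps)
    also have "\<dots> = (\<Sum>i\<le>M-n. e i * p (n+i) z * h ^ i) + p n z"
      by (simp add: sum.distrib)
    finally show ?thesis by (simp add: r_def)
  qed
  have conv: "(\<Sum>i\<le>k. \<beta> i * e (k - i)) = fps_nth (fps_X * fps_exp (of_real \<alpha>)) k" for k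
    unfolding bernoulli_fps_mult_exp[symmetric] fps_mult_nth \<beta>_def e_def by (simp add: atMost_atLeast0)
  have "(\<Sum>n\<le>M. \<beta> n * h ^ n * (\<Sum>i\<le>M-n. e i * p (n+i) z * h ^ i))
        = (\<Sum>n\<le>M. \<Sum>i\<le>M-n. \<beta> n * e i * p (n+i) z * h ^ (n + i))"
    by (simp add: sum_distrib_left power_add mult_ac)
  also have "\<dots> = (\<Sum>(n,i)\<in>{(n,i). n + i \<le> M}. \<beta> n * e i * p (n+i) z * h ^ (n + i))"
    by (subst sum.Sigma) (auto intro!: sum.cong)
  also have "\<dots> = (\<Sum>k\<le>M. \<Sum>n\<le>k. \<beta> n * e (k - n) * p (n+(k-n)) z * h ^ (n + (k-n)))"
    by (rule sum.triangle_reindex_eq)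
  also have "\<dots> = (\<Sum>k\<le>M. (\<Sum>n\<le>k. \<beta> n * e (k - n)) * p k z * h ^ k)"
    by (simp add: sum_distrib_right)
  also have "\<dots> = (\<Sum>k\<le>M. fps_nth (fps_X * fps_exp (of_real \<alpha>)) k * p k z * h ^ k)"
    by (simp only: conv)
  also have "\<dots> = (\<Sum>i\<le>N. h * (p (Suc i) z * (of_real \<alpha> * h) ^ i / fact i))"
    unfolding M_def by (subst sum.atMost_Suc_shift) (simp add: power_mult_distrib mult_ac)
  finally have main: "(\<Sum>n\<le>M. \<beta> n * h ^ n * (\<Sum>i\<le>M-n. e i * p (n+i) z * h ^ i)) =
      h * (\<Sum>i\<le>N. p (Suc i) z * (of_real \<alpha> * h) ^ i / fact i)"
    by (simp add: sum_distrib_left)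
  have "h * p 1 (z + of_real \<alpha> * h) - (\<Sum>n\<le>M. \<beta> n * h ^ n * (p n (z + h) - p n z))
     = h * r1 - (\<Sum>n\<le>M. \<beta> n * h ^ n * r n)"
    unfolding diff ring_distribs sum.distrib main r1_def by (simp add: algebra_simps)
  also have "norm \<dots> \<le> norm h * (B * norm h ^ M) + (\<Sum>n\<le>M. norm (\<beta> n) * norm h ^ n * (B * norm h ^ Suc (M - n)))"
    using r r1
    by (intro order_trans[OF norm_triangle_ineq4] add_mono sum_norm_le)
       (auto simp: norm_mult norm_power intro!: mult_left_mono)
  also have "(\<Sum>n\<le>M. norm (\<beta> n) * norm h ^ n * (B * norm h ^ Suc (M - n))) =
             (\<Sum>n\<le>M. norm (\<beta> n) * (B * norm h ^ Suc M))"
  proof (intro sum.cong refl)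
    fix n assume "n \<in> {..M}"
    hence "norm h ^ Suc M = norm h ^ n * norm h ^ Suc (M - n)"
      by (simp flip: power_add add: Suc_diff_le)
    thus "norm (\<beta> n) * norm h ^ n * (B * norm h ^ Suc (M - n)) = norm (\<beta> n) * (B * norm h ^ Suc M)"
      by (simp only: mult_ac)
  qed
  also have "norm h * (B * norm h ^ M) + (\<Sum>n\<le>M. norm (\<beta> n) * (B * norm h ^ Suc M)) =
    (1 + (\<Sum>n\<le>M. norm (\<beta> n))) * B * norm h ^ (N + 2)"
    by (simp add: M_def algebra_simps sum_distrib_left sum_distrib_right)
  finally show ?thesis unfolding \<beta>_def M_def .
qed

section \<open>Cones and quadratic decay\<close>

text \<open>
  For \<open>0 < \<delta> \<le> 1\<close> this is the closed sector of half-angle \<open>arccos \<delta>\<close> about the positive axis.  Bounding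
  the real part instead of the argument makes convexity and closedness immediate.
\<close>

definition acute_cone :: "real \<Rightarrow> complex set" where
  "acute_cone \<delta> = {z. \<delta> * norm z \<le> Re z}"

lemma acute_cone_cmult:
  assumes "z \<in> acute_cone \<delta>" "0 \<le> a"
  shows "of_real a * z \<in> acute_cone \<delta>"
proof -
  have "a * (\<delta> * norm z) \<le> a * Re z"
    using assms by (intro mult_left_mono) (auto simp: acute_cone_def)
  thus ?thesis using assms by (simp add: acute_cone_def norm_mult mult.left_commute)
qed

lemma acute_cone_add:
  assumes "0 \<le> \<delta>" "z \<in> acute_cone \<delta>" "w \<in> acute_cone \<delta>"
  shows "z + w \<in> acute_cone \<delta>"
proof -
  have "\<delta> * norm (z + w) \<le> \<delta> * (norm z + norm w)"
    using assms by (intro mult_left_mono norm_triangle_ineq)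
  thus ?thesis using assms by (simp add: acute_cone_def distrib_left)
qed

lemma convex_acute_cone: "0 \<le> \<delta> \<Longrightarrow> convex (acute_cone \<delta>)"
  unfolding convex_def scaleR_conv_of_real by (blast intro: acute_cone_add acute_cone_cmult)

lemma closed_acute_cone: "closed (acute_cone \<delta>)"
  unfolding acute_cone_def by (intro closed_Collect_le continuous_intros)

lemma acute_cone_subset:
  assumes "0 < \<delta>"
  shows "acute_cone \<delta> \<subseteq> insert 0 right_half_plane"
proof
  fix z assume "z \<in> acute_cone \<delta>"
  hence "\<delta> * norm z \<le> Re z" by (simp add: acute_cone_def)
  moreover have "\<delta> * norm z > 0" if "z \<noteq> 0" using that assms by simp
  ultimately show "z \<in> insert 0 right_half_plane"
    unfolding right_half_plane_def by fastforce
qed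

text \<open>
  On the compact part of the cone continuity gives a bound, so decay needs to be checked near infinity only.
\<close>

lemma cone_decay_from_far:
  fixes q :: "complex \<Rightarrow> complex"
  assumes cont: "continuous_on (acute_cone \<delta>) q"
  assumes far: "\<And>z. z \<in> acute_cone \<delta> \<Longrightarrow> R \<le> norm z \<Longrightarrow> norm (q z) \<le> C / (1 + norm z)\<^sup>2"
  shows "\<exists>C. \<forall>z\<in>acute_cone \<delta>. norm (q z) \<le> C / (1 + norm z)\<^sup>2"
proof -
  have "compact (cball 0 R \<inter> acute_cone \<delta>)"
    by (intro compact_Int_closed compact_cball closed_acute_cone)
  moreover have "continuous_on (cball 0 R \<inter> acute_cone \<delta>) (\<lambda>z. q z * of_real ((1 + norm z)\<^sup>2))"
    by (intro continuous_intros continuous_on_subset[OF cont]) auto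
  ultimately have "bounded ((\<lambda>z. q z * of_real ((1 + norm z)\<^sup>2)) ` (cball 0 R \<inter> acute_cone \<delta>))"
    by (intro compact_imp_bounded compact_continuous_image)
  then obtain C2 where C2: "\<And>z. z \<in> cball 0 R \<inter> acute_cone \<delta> \<Longrightarrow>
       norm (q z * of_real ((1 + norm z)\<^sup>2)) \<le> C2"
    unfolding bounded_iff by (metis (no_types, lifting) imageI)
  have near: "norm (q z) \<le> C2 / (1 + norm z)\<^sup>2"
    if z: "z \<in> acute_cone \<delta>" "norm z \<le> R" for z
  proof -
    have pos: "(1 + norm z)\<^sup>2 > 0" by (intro zero_less_power add_pos_nonneg) auto
    have "norm (q z) * (1 + norm z)\<^sup>2 = norm (q z * of_real ((1 + norm z)\<^sup>2))"
      unfolding norm_mult norm_of_real using pos by simp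
    also have "\<dots> \<le> C2" using z by (intro C2) auto
    finally show ?thesis using pos by (simp add: pos_le_divide_eq)
  qed
  show ?thesis
  proof (intro exI[of _ "max C C2"] ballI)
    fix z assume z: "z \<in> acute_cone \<delta>"
    have "norm (q z) \<le> (if R \<le> norm z then C else C2) / (1 + norm z)\<^sup>2"
      using near[OF z] far[OF z] by auto
    also have "\<dots> \<le> max C C2 / (1 + norm z)\<^sup>2"
      by (intro divide_right_mono) auto
    finally show "norm (q z) \<le> max C C2 / (1 + norm z)\<^sup>2" .
  qed
qed

lemma acute_coneI:
  assumes "0 < Re z"
  obtains \<delta> where "0 < \<delta>" "z \<in> acute_cone \<delta>"
proof
  have "z \<noteq> 0" using assms by auto
  thus "0 < Re z / norm z" "z \<in> acute_cone (Re z / norm z)"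
    using assms by (auto simp: acute_cone_def)
qed

lemma sector_subset_acute_cone:
  assumes "\<phi> < pi / 2" and z: "z \<in> sector \<phi>" "z \<in> right_half_plane"
  shows "0 < cos \<phi>" "z \<in> acute_cone (cos \<phi>)"
proof -
  have "z \<noteq> 0" using z by (auto simp: right_half_plane_def)
  hence arg: "\<bar>Arg z\<bar> < \<phi>" using z by (auto simp: sector_def sector_punctured_def)
  thus "0 < cos \<phi>" using assms by (intro cos_gt_zero_pi) auto
  have "cos \<phi> \<le> cos \<bar>Arg z\<bar>" using arg assms by (intro cos_monotone_0_pi_le) auto
  hence "cos \<phi> * norm z \<le> norm z * cos (Arg z)"
    by (simp add: mult.commute mult_left_mono)
  also have "\<dots> = Re z" by (metis Re_rcis rcis_cmod_Arg)
  finally show "z \<in> acute_cone (cos \<phi>)" by (simp add: acute_cone_def)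
qed

lemma cone_decay_of_quadratic:
  fixes q :: "complex \<Rightarrow> complex"
  assumes "continuous_on (acute_cone \<delta>) q"
  assumes "\<And>z. z \<in> acute_cone \<delta> \<Longrightarrow> R \<le> norm z \<Longrightarrow> (norm z)\<^sup>2 * norm (q z) \<le> C"
  shows "\<exists>C. \<forall>z\<in>acute_cone \<delta>. norm (q z) \<le> C / (1 + norm z)\<^sup>2"
proof (rule cone_decay_from_far[OF assms(1), where R = "max 1 R" and C = "4 * C"])
  fix z assume z: "z \<in> acute_cone \<delta>" "max 1 R \<le> norm z"
  have "(1 + norm z)\<^sup>2 \<le> (2 * norm z)\<^sup>2" using z by (intro power_mono) auto
  hence "(1 + norm z)\<^sup>2 * norm (q z) \<le> (2 * norm z)\<^sup>2 * norm (q z)" by (intro mult_right_mono) auto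
  also have "\<dots> = 4 * ((norm z)\<^sup>2 * norm (q z))" by (simp add: power2_eq_square)
  also have "\<dots> \<le> 4 * C" using assms(2) z by simp
  finally have "norm (q z) * (1 + norm z)\<^sup>2 \<le> 4 * C" by (simp add: mult.commute)
  moreover have "(1 + norm z)\<^sup>2 > 0" by (intro zero_less_power add_pos_nonneg) auto
  ultimately show "norm (q z) \<le> 4 * C / (1 + norm z)\<^sup>2" by (simp add: pos_le_divide_eq)
qed

text \<open>
  Without the term \<open>m = 0\<close> the series is dominated by a telescoping one with sum \<open>1 / s\<close>; the whole is
  \<open>1 / s\<close> times a Riemann sum for \<open>1 / (1 + x)^2\<close>, so this order in \<open>s\<close> is the right one.
\<close>

lemma sum_inverse_square_le:
  assumes s: "0 < (s::real)" "s \<le> 1"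
  shows "summable (\<lambda>m::nat. 1 / (1 + real m * s)\<^sup>2)" "(\<Sum>m. 1 / (1 + real m * s)\<^sup>2) \<le> 2 / s"
proof -
  let ?a = "\<lambda>m::nat. 1 / (1 + real m * s)"
  have lim: "?a \<longlonglongrightarrow> 0" using s by real_asymp
  have sums: "(\<lambda>m. (1/s) * (?a m - ?a (Suc m))) sums ((1/s) * (?a 0 - 0))"
    by (intro sums_mult telescope_sums' lim)
  have le: "1 / (1 + real (Suc m) * s)\<^sup>2 \<le> (1/s) * (?a m - ?a (Suc m))" for m
  proof -
    have p: "1 + real m * s > 0" "1 + real (Suc m) * s > 0" using s by (auto intro!: add_pos_nonneg)
    have "(1/s) * (?a m - ?a (Suc m)) = 1 / ((1 + real m * s) * (1 + real (Suc m) * s))"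
      using s p by (simp add: divide_simps) (simp add: algebra_simps)
    also have "\<dots> \<ge> 1 / (1 + real (Suc m) * s)\<^sup>2"
      using p s unfolding power2_eq_square by (intro divide_left_mono mult_right_mono mult_pos_pos) auto
    finally show ?thesis by simp
  qed
  have sm: "summable (\<lambda>m::nat. 1 / (1 + real (Suc m) * s)\<^sup>2)"
    by (rule summable_comparison_test'[OF sums_summable[OF sums], of 0]) (use le in auto)
  thus S: "summable (\<lambda>m::nat. 1 / (1 + real m * s)\<^sup>2)"
    by (subst (asm) summable_Suc_iff)
  have "(\<Sum>m. 1 / (1 + real (Suc m) * s)\<^sup>2) \<le> 1/s"
    using suminf_le[OF le sm sums_summable[OF sums]] sums_unique[OF sums] by simp
  hence "(\<Sum>m. 1 / (1 + real m * s)\<^sup>2) \<le> 1/s + 1"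
    using suminf_split_head[OF S] by simp
  moreover have "1 \<le> 1/s" using s by simp
  ultimately show "(\<Sum>m. 1 / (1 + real m * s)\<^sup>2) \<le> 2 / s" by simp
qed
section \<open>Shifted sums of functions decaying in cones\<close>

text \<open>
  The decay is only required in each cone separately, with a constant depending on \<open>\<delta>\<close>, because
  \<open>exp (- z)\<close> does not decay in the whole half-plane.
\<close>

locale cone_decaying =
  fixes g :: "complex \<Rightarrow> complex" and \<rho> :: real
  assumes radius_pos: "0 < \<rho>"
  assumes holomorphic: "g holomorphic_on (right_half_plane \<union> ball 0 \<rho>)"
  assumes decay: "\<And>\<delta>. 0 < \<delta> \<Longrightarrow> \<exists>C. \<forall>z\<in>acute_cone \<delta>. norm (g z) \<le> C / (1 + norm z)\<^sup>2"
begin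

definition region :: "complex set" where "region = right_half_plane \<union> ball 0 \<rho>"

lemma open_region: "open region"
  unfolding region_def right_half_plane_def by (intro open_Un open_halfspace_Re_gt open_ball)

lemma holomorphic_region: "g holomorphic_on region"
  using holomorphic by (simp add: region_def)

lemma zero_in_region: "0 \<in> region"
  using radius_pos by (simp add: region_def)

lemma acute_cone_subset_region: "0 < \<delta> \<Longrightarrow> acute_cone \<delta> \<subseteq> region"
  using acute_cone_subset[of \<delta>] zero_in_region by (auto simp: region_def)

lemma starlike_region: "starlike region"
  unfolding starlike_def
proof (intro bexI[OF _ zero_in_region] ballI subsetI)
  fix z w assume z: "z \<in> region" and "w \<in> closed_segment 0 z"
  then obtain u where u: "0 \<le> u" "u \<le> 1" "w = of_real u * z"
    by (auto simp: in_segment scaleR_conv_of_real)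
  show "w \<in> region"
  proof (cases "u = 0")
    case True
    thus ?thesis using zero_in_region u by simp
  next
    case False
    have "u * norm z \<le> norm z" using u by (intro mult_left_le_one_le) auto
    hence "norm w < \<rho>" if "norm z < \<rho>" using u that by (simp add: norm_mult)
    moreover have "Re w > 0" if "Re z > 0" using False u that by simp
    ultimately show ?thesis using z by (auto simp: region_def right_half_plane_def)
  qed
qed

text \<open>
  Far out, the unit disc about a point of \<open>acute_cone \<delta>\<close> lies in \<open>acute_cone (\<delta>/2)\<close>, so Cauchy's
  estimate on that disc carries the decay of \<open>g\<close> in the wider cone over to its derivatives in the narrower one.
\<close>

lemma higher_deriv_decay:
  assumes \<delta>: "0 < \<delta>"
  shows "\<exists>C. \<forall>z\<in>acute_cone \<delta>. norm ((deriv ^^ n) g z) \<le> C / (1 + norm z)\<^sup>2"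
proof -
  \<comment> \<open>If \<open>norm z \<ge> R\<close> and \<open>norm (w - z) \<le> 1\<close>, then \<open>Re w \<ge> \<delta> * norm z - 1 \<ge> \<delta> * norm w - \<delta> - 1\<close>;
    this is at least \<open>\<delta>/2 * norm w\<close> once \<open>norm w \<ge> 2 * (\<delta> + 1) / \<delta>\<close>.\<close>
  define R where "R = 2 + 2 * (\<delta> + 1) / \<delta>"
  obtain C1 where C1: "\<And>z. z \<in> acute_cone (\<delta>/2) \<Longrightarrow> norm (g z) \<le> C1 / (1 + norm z)\<^sup>2"
    using decay[of "\<delta>/2"] \<delta> by auto
  have C10: "C1 \<ge> 0" using C1[of 0] order_trans[OF norm_ge_zero] by (force simp: acute_cone_def)
  have far: "norm ((deriv ^^ n) g z) \<le> (fact n * C1 * 4) / (1 + norm z)\<^sup>2"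
    if z: "z \<in> acute_cone \<delta>" "norm z \<ge> R" for z
  proof -
    have R2: "norm z \<ge> 2" using z \<delta> by (simp add: R_def)
        (smt (verit) divide_nonneg_pos)
    have sub: "cball z 1 \<subseteq> acute_cone (\<delta>/2)"
    proof
      fix w assume "w \<in> cball z 1"
      hence w: "norm (z - w) \<le> 1" by (simp add: dist_norm)
      have "Re z - Re w \<le> 1" using complex_Re_le_cmod[of "z - w"] w by simp
      moreover have "norm w \<le> norm z + 1" using w norm_triangle_ineq3[of z w] by linarith
      hence "\<delta> * norm w \<le> \<delta> * (norm z + 1)" using \<delta> by simp
      moreover have "\<delta> * norm z \<le> Re z" using z by (simp add: acute_cone_def)
      moreover have "norm w \<ge> R - 1" using w z norm_triangle_ineq3[of z w] by linarith
      hence "\<delta> * norm w \<ge> \<delta> * (R - 1)" using \<delta> by simp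
      moreover have "\<delta> * (R - 1) = \<delta> + 2 * (\<delta> + 1)" using \<delta> by (simp add: R_def field_simps)
      ultimately show "w \<in> acute_cone (\<delta>/2)" using \<delta>
        by (simp add: acute_cone_def field_simps)
    qed
    hence sub': "cball z 1 \<subseteq> region" using acute_cone_subset_region[of "\<delta>/2"] \<delta> by auto
    have "norm ((deriv ^^ n) g z) \<le> fact n * (C1 / (norm z)\<^sup>2) / 1 ^ n"
    proof (rule Cauchy_inequality)
      show "g holomorphic_on ball z 1"
        using holomorphic_region sub' by (meson ball_subset_cball holomorphic_on_subset subset_trans)
      show "continuous_on (cball z 1) g"
        using holomorphic_region sub' by (meson holomorphic_on_imp_continuous_on continuous_on_subset)
      fix x assume x: "norm (z - x) = 1"
      have "norm (g x) \<le> C1 / (1 + norm x)\<^sup>2"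
        using x sub by (intro C1) (auto simp: dist_norm)
      also have "\<dots> \<le> C1 / (norm z)\<^sup>2"
      proof (intro divide_left_mono power_mono mult_pos_pos zero_less_power)
        show "norm z \<le> 1 + norm x" using x norm_triangle_ineq3[of z x] by linarith
        show "0 < 1 + norm x" by (intro add_pos_nonneg) auto
        show "0 < norm z" using R2 by linarith
      qed (use C10 in auto)
      finally show "norm (g x) \<le> C1 / (norm z)\<^sup>2" .
    qed auto
    also have "\<dots> = (fact n * C1 * 4) / (2 * norm z)\<^sup>2" by (simp add: power2_eq_square)
    also have "\<dots> \<le> (fact n * C1 * 4) / (1 + norm z)\<^sup>2"
      using C10 R2 by (intro divide_left_mono power_mono mult_pos_pos mult_nonneg_nonneg)
                      (auto simp: add_pos_nonneg)
    finally show ?thesis .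
  qed
  have "continuous_on (acute_cone \<delta>) ((deriv ^^ n) g)"
    using holomorphic_higher_deriv[OF holomorphic_region open_region, of n] acute_cone_subset_region[OF \<delta>]
    by (meson holomorphic_on_imp_continuous_on continuous_on_subset)
  thus ?thesis using far by (rule cone_decay_from_far)
qed

lemma ex_primitive: "\<exists>P. P 0 = 0 \<and> (\<forall>z\<in>region. (P has_field_derivative g z) (at z))"
proof -
  have "\<exists>P. \<forall>z\<in>region. (P has_field_derivative g z) (at z)"
  proof (rule holomorphic_starlike_primitive[OF _ starlike_region open_region, of _ "{}"])
    show "continuous_on region g" using holomorphic_region by (rule holomorphic_on_imp_continuous_on)
    show "g field_differentiable at x" if "x \<in> region - {}" for x
      using holomorphic_region open_region that by (auto simp: holomorphic_on_open field_differentiable_def)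
  qed auto
  then obtain P where P: "\<And>z. z \<in> region \<Longrightarrow> (P has_field_derivative g z) (at z)" by blast
  show ?thesis
    by (rule exI[of _ "\<lambda>z. P z - P 0"]) (auto intro!: derivative_eq_intros P)
qed

definition primitive :: "complex \<Rightarrow> complex" where
  "primitive = (SOME P. P 0 = 0 \<and> (\<forall>z\<in>region. (P has_field_derivative g z) (at z)))"

lemma primitive_0: "primitive 0 = 0"
  and primitive_deriv: "z \<in> region \<Longrightarrow> (primitive has_field_derivative g z) (at z)"
  using someI_ex[OF ex_primitive] unfolding primitive_def by auto

lemma of_real_in_acute_cone: "0 \<le> x \<Longrightarrow> \<delta> \<le> 1 \<Longrightarrow> of_real x \<in> acute_cone \<delta>"
  using mult_right_mono[of \<delta> 1 x] by (simp add: acute_cone_def)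

lemma of_real_in_region: "0 \<le> x \<Longrightarrow> of_real x \<in> region"
  using of_real_in_acute_cone[of x 1] acute_cone_subset_region[of 1] by auto

lemma set_integrable_half_line: "set_integrable lborel {0<..} (\<lambda>x. g (of_real x))"
proof -
  obtain C where C: "\<And>z. z \<in> acute_cone 1 \<Longrightarrow> norm (g z) \<le> C / (1 + norm z)\<^sup>2"
    using decay[of 1] by auto
  have C0: "C \<ge> 0" using C[of 0] order_trans[OF norm_ge_zero] by (force simp: acute_cone_def)
  have "set_integrable lborel (einterval (ereal 0) \<infinity>) (\<lambda>x. C / (1 + x)\<^sup>2)"
  proof (rule interval_integral_FTC_nonneg(1)[where F = "\<lambda>x. - C / (1 + x)"])
    show "(((\<lambda>x. - C / (1 + x)) \<circ> real_of_ereal) \<longlongrightarrow> - C) (at_right (ereal 0))"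
      unfolding ereal_tendsto_simps1 by (auto intro!: tendsto_eq_intros)
    have "((\<lambda>x::real. - C / (1 + x)) \<longlongrightarrow> 0) at_top" by real_asymp
    thus "(((\<lambda>x. - C / (1 + x)) \<circ> real_of_ereal) \<longlongrightarrow> 0) (at_left \<infinity>)"
      unfolding ereal_tendsto_simps1 .
  next
    fix x :: real assume "ereal 0 < ereal x"
    hence x: "1 + x > 0" by simp
    show "((\<lambda>x. - C / (1 + x)) has_real_derivative C / (1 + x)\<^sup>2) (at x)"
      using x by (auto intro!: derivative_eq_intros simp: power2_eq_square)
    show "isCont (\<lambda>x. C / (1 + x)\<^sup>2) x" using x by (intro continuous_intros) auto
  qed (use C0 in auto)
  also have "einterval (ereal 0) \<infinity> = {0<..}" by (auto simp: einterval_def)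
  finally have int: "set_integrable lborel {0<..} (\<lambda>x. C / (1 + x)\<^sup>2)" .
  show ?thesis
  proof (rule set_integrable_bound[OF int])
    have "continuous_on {0<..} (\<lambda>x::real. g (of_real x))"
      using of_real_in_region
      by (intro continuous_on_compose2[OF holomorphic_on_imp_continuous_on[OF holomorphic_region]] continuous_intros) auto
    thus "set_borel_measurable lborel {0<..} (\<lambda>x. g (complex_of_real x))"
      unfolding set_borel_measurable_def by (simp add: borel_measurable_continuous_on_indicator)
    show "AE x in lborel. x \<in> {0<..} \<longrightarrow> norm (g (of_real x)) \<le> norm (C / (1 + x)\<^sup>2)"
    proof (intro AE_I2 impI)
      fix x :: real assume "x \<in> {0<..}"
      thus "norm (g (of_real x)) \<le> norm (C / (1 + x)\<^sup>2)"
        using C[of "of_real x"] of_real_in_acute_cone[of x 1] C0 by simp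
    qed
  qed
qed

definition half_line_integral :: complex where
  "half_line_integral = (LINT x:{0<..}|lborel. g (of_real x))"

lemma primitive_tendsto_integral:
  "((\<lambda>x::real. primitive (of_real x)) \<longlongrightarrow> half_line_integral) at_top"
proof -
  have "((\<lambda>y. \<integral>x. indicator {..y} x *\<^sub>R (indicator {0<..} x *\<^sub>R g (of_real x)) \<partial>lborel)
           \<longlongrightarrow> half_line_integral) at_top"
    unfolding half_line_integral_def set_lebesgue_integral_def
    using set_integrable_half_line
    by (intro tendsto_integral_at_top) (auto simp: set_integrable_def)
  moreover have "eventually (\<lambda>y. (\<integral>x. indicator {..y} x *\<^sub>R (indicator {0<..} x *\<^sub>R g (of_real x)) \<partial>lborel)
       = primitive (of_real y)) at_top"
    using eventually_ge_at_top[of 0]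
  proof eventually_elim
    fix y :: real assume y: "y \<ge> 0"
    have "(\<integral>x. indicator {..y} x *\<^sub>R (indicator {0<..} x *\<^sub>R g (of_real x)) \<partial>lborel) =
          (\<integral>x. indicator {0..y} x *\<^sub>R g (of_real x) \<partial>lborel)"
    proof (rule integral_cong_AE)
      show "AE x in lborel. indicator {..y} x *\<^sub>R (indicator {0<..} x *\<^sub>R g (of_real x)) =
               indicator {0..y} x *\<^sub>R g (of_real x)"
        using AE_lborel_singleton[of 0] by eventually_elim (auto simp: indicator_def)
      have m: "(\<lambda>x. indicator {0<..} x *\<^sub>R g (of_real x)) \<in> borel_measurable lborel"
        using set_integrable_half_line by (auto simp: set_integrable_def)
      thus "(\<lambda>x. indicator {..y} x *\<^sub>R (indicator {0<..} x *\<^sub>R g (of_real x))) \<in> borel_measurable lborel"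
        by measurable
      have "continuous_on {0..y} (\<lambda>x::real. g (of_real x))"
        using of_real_in_region
        by (intro continuous_on_compose2[OF holomorphic_on_imp_continuous_on[OF holomorphic_region]] continuous_intros) auto
      thus "(\<lambda>x. indicator {0..y} x *\<^sub>R g (of_real x)) \<in> borel_measurable lborel"
        by (simp add: borel_measurable_continuous_on_indicator)
    qed
    also have "\<dots> = primitive (of_real y) - primitive (of_real 0)"
    proof (rule integral_FTC_Icc[OF y])
      fix x assume "0 \<le> x" "x \<le> y"
      hence d: "of_real x \<in> region" by (intro of_real_in_region)
      show "((\<lambda>x. primitive (of_real x)) has_vector_derivative g (of_real x)) (at x within {0..y})"
        using has_vector_derivative_real_field[OF primitive_deriv[OF d]]
        by (rule has_vector_derivative_at_within)
    next
      show "continuous_on {0..y} (\<lambda>x::real. g (of_real x))"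
        using of_real_in_region
        by (intro continuous_on_compose2[OF holomorphic_on_imp_continuous_on[OF holomorphic_region]] continuous_intros) auto
    qed
    finally show "(\<integral>x. indicator {..y} x *\<^sub>R (indicator {0<..} x *\<^sub>R g (of_real x)) \<partial>lborel) = primitive (of_real y)"
      by (simp add: primitive_0)
  qed
  ultimately show ?thesis by (rule Lim_transform_eventually)
qed

text \<open>
  This replaces rotating the contour from the positive axis to the ray through \<open>h\<close>: the points \<open>m * h\<close> and
  \<open>m * norm h\<close> are joined by a segment of length \<open>O(m)\<close> on which \<open>g = O(1 / m^2)\<close>.
\<close>

lemma primitive_tendsto_integral_ray:
  assumes \<delta>: "0 < \<delta>" and h: "h \<in> acute_cone \<delta>" "h \<noteq> 0"
  shows "(\<lambda>m. primitive (of_nat m * h)) \<longlonglongrightarrow> half_line_integral"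
proof -
  have \<delta>1: "\<delta> \<le> 1"
  proof -
    have "\<delta> * norm h \<le> Re h" using h by (simp add: acute_cone_def)
    also have "\<dots> \<le> 1 * norm h" using complex_Re_le_cmod[of h] by simp
    finally have "\<delta> * norm h \<le> 1 * norm h" .
    moreover have "0 < norm h" using h by simp
    ultimately show ?thesis by (simp only: mult_le_cancel_right_pos)
  qed
  obtain C where C: "\<And>z. z \<in> acute_cone \<delta> \<Longrightarrow> norm (g z) \<le> C / (1 + norm z)\<^sup>2"
    using decay[of \<delta>] \<delta> by auto
  have C0: "C \<ge> 0" using C[of 0] order_trans[OF norm_ge_zero] by (force simp: acute_cone_def)
  define s where "s = norm h"
  have s: "s > 0" using h by (simp add: s_def)
  have bound: "norm (primitive (of_nat m * h) - primitive (of_real (real m * s)))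
                 \<le> C / (1 + \<delta> * (real m * s))\<^sup>2 * (2 * (real m * s))" for m
  proof -
    \<comment> \<open>A convex set containing both points, on which \<open>norm z\<close> is bounded below.\<close>
    define T where "T = acute_cone \<delta> \<inter> {z. \<delta> * (real m * s) \<le> Re z}"
    have le1: "norm (primitive (of_nat m * h) - primitive (of_real (real m * s)))
            \<le> C / (1 + \<delta> * (real m * s))\<^sup>2 * norm (of_nat m * h - of_real (real m * s))"
    proof (rule field_differentiable_bound)
      show "convex T" unfolding T_def using \<delta>
        by (intro convex_Int convex_acute_cone convex_halfspace_Re_ge) auto
      fix z assume z: "z \<in> T"
      show "(primitive has_field_derivative g z) (at z within T)"
        using z acute_cone_subset_region[OF \<delta>]
        by (intro has_field_derivative_at_within[OF primitive_deriv]) (auto simp: T_def)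
      have "norm (g z) \<le> C / (1 + norm z)\<^sup>2" using z by (intro C) (auto simp: T_def)
      also have "\<dots> \<le> C / (1 + \<delta> * (real m * s))\<^sup>2"
        using z C0 \<delta> s complex_Re_le_cmod[of z]
        by (intro divide_left_mono power_mono mult_pos_pos zero_less_power add_pos_nonneg add_left_mono)
           (auto simp: T_def)
      finally show "norm (g z) \<le> C / (1 + \<delta> * (real m * s))\<^sup>2" .
    next
      have "\<delta> * s \<le> Re h" using h by (simp add: acute_cone_def s_def)
      hence "real m * (\<delta> * s) \<le> real m * Re h" by (intro mult_left_mono) auto
      thus "of_nat m * h \<in> T"
        using acute_cone_cmult[OF h(1), of "real m"] by (simp add: T_def mult.left_commute)
      have "\<delta> * (real m * s) \<le> 1 * (real m * s)" using \<delta>1 s by (intro mult_right_mono) auto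
      thus "of_real (real m * s) \<in> T"
        using of_real_in_acute_cone[of "real m * s" \<delta>] \<delta>1 s by (simp add: T_def)
    qed
    have "norm (of_nat m * h - of_real (real m * s)) \<le> 2 * (real m * s)"
    proof -
      have "norm (of_nat m * h - of_real (real m * s)) \<le> norm (of_nat m * h) + norm (complex_of_real (real m * s))"
        by (rule norm_triangle_ineq4)
      also have "\<dots> = 2 * (real m * s)" using s unfolding norm_of_real by (simp add: norm_mult s_def)
      finally show ?thesis .
    qed
    hence "C / (1 + \<delta> * (real m * s))\<^sup>2 * norm (of_nat m * h - of_real (real m * s))
             \<le> C / (1 + \<delta> * (real m * s))\<^sup>2 * (2 * (real m * s))"
      using C0 by (intro mult_left_mono) auto
    with le1 show ?thesis by (rule order_trans)
  qed
  have "(\<lambda>m::nat. C / (1 + \<delta> * (real m * s))\<^sup>2 * (2 * (real m * s))) \<longlonglongrightarrow> 0"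
    using \<delta> s by real_asymp
  hence "(\<lambda>m. primitive (of_nat m * h) - primitive (of_real (real m * s))) \<longlonglongrightarrow> 0"
    by (rule Lim_null_comparison[rotated]) (intro always_eventually allI bound)
  moreover have "filterlim (\<lambda>m::nat. real m * s) at_top sequentially"
    using s by real_asymp
  from filterlim_compose[OF primitive_tendsto_integral this]
  have "(\<lambda>m. primitive (of_real (real m * s))) \<longlonglongrightarrow> half_line_integral" .
  ultimately have "(\<lambda>m. (primitive (of_nat m * h) - primitive (of_real (real m * s))) + primitive (of_real (real m * s)))
      \<longlonglongrightarrow> 0 + half_line_integral"
    by (rule tendsto_add)
  thus ?thesis by simp
qed

lemma summable_shifted:
  assumes \<delta>: "0 < \<delta>" and h: "h \<in> acute_cone \<delta>" "h \<noteq> 0" and \<alpha>: "0 \<le> \<alpha>"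
  shows "summable (\<lambda>m. g ((of_nat m + of_real \<alpha>) * h))"
proof -
  obtain C where C: "\<And>z. z \<in> acute_cone \<delta> \<Longrightarrow> norm (g z) \<le> C / (1 + norm z)\<^sup>2"
    using decay[of \<delta>] \<delta> by auto
  have C0: "C \<ge> 0" using C[of 0] order_trans[OF norm_ge_zero] by (force simp: acute_cone_def)
  define s where "s = min 1 (norm h)"
  have s: "0 < s" "s \<le> 1" using h by (auto simp: s_def)
  show ?thesis
  proof (rule summable_comparison_test')
    show "summable (\<lambda>m. C * (1 / (1 + real m * s)\<^sup>2))"
      by (intro summable_mult sum_inverse_square_le(1) s)
    fix m :: nat
    have eq: "(of_nat m + of_real \<alpha>) * h = of_real (real m + \<alpha>) * h" by simp
    have "norm (g ((of_nat m + of_real \<alpha>) * h)) \<le> C / (1 + norm ((of_nat m + of_real \<alpha>) * h))\<^sup>2"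
      unfolding eq using \<alpha> h by (intro C acute_cone_cmult) auto
    also have "norm ((of_nat m + of_real \<alpha>) * h) = (real m + \<alpha>) * norm h"
      unfolding eq norm_mult norm_of_real using \<alpha> by simp
    also have "C / (1 + (real m + \<alpha>) * norm h)\<^sup>2 \<le> C / (1 + real m * s)\<^sup>2"
      using C0 s \<alpha>
      by (intro divide_left_mono power_mono mult_pos_pos zero_less_power add_pos_nonneg add_left_mono mult_mono)
         (auto simp: s_def)
    finally show "norm (g ((of_nat m + of_real \<alpha>) * h)) \<le> C * (1 / (1 + real m * s)\<^sup>2)" by simp
  qed
qed

text \<open>
  Summing \<open>euler_maclaurin_step\<close> over the segments from \<open>m * h\<close> to \<open>(m + 1) * h\<close>, which lie in the same
  cone as \<open>h\<close>, telescopes.  The decay in the cone is the only input, hence the uniformity in \<open>h\<close>.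
\<close>

theorem shifted_sum_asymptotics:
  assumes \<delta>: "0 < \<delta>" and \<alpha>: "0 \<le> \<alpha>" "\<alpha> \<le> 1"
  shows "\<exists>C. \<forall>h\<in>acute_cone \<delta>. h \<noteq> 0 \<longrightarrow> norm h \<le> 1 \<longrightarrow>
           norm (h * (\<Sum>m. g ((of_nat m + of_real \<alpha>) * h)) -
                 (half_line_integral -
                   (\<Sum>n\<le>N. fps_nth (bernoulli_fps \<alpha>) (Suc n) * (deriv ^^ n) g 0 * h ^ Suc n)))
           \<le> C * norm h ^ Suc N"
proof -
  define p where "p = (\<lambda>n. case n of 0 \<Rightarrow> primitive | Suc n \<Rightarrow> (deriv ^^ n) g)"
  define \<beta> where "\<beta> = fps_nth (bernoulli_fps \<alpha>)"
  have p_deriv: "(p n has_field_derivative p (Suc n) z) (at z)" if "z \<in> region" for n z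
  proof (cases n)
    case 0
    thus ?thesis using primitive_deriv[OF that] by (simp add: p_def)
  next
    case (Suc k)
    thus ?thesis using has_field_derivative_higher_deriv[OF holomorphic_region open_region that, of k]
      by (simp add: p_def)
  qed
  obtain C where C: "\<And>z. z \<in> acute_cone \<delta> \<Longrightarrow> norm ((deriv ^^ Suc N) g z) \<le> C / (1 + norm z)\<^sup>2"
    using higher_deriv_decay[OF \<delta>] by blast
  have C0: "C \<ge> 0" using C[of 0] order_trans[OF norm_ge_zero] by (force simp: acute_cone_def)
  define K where "K = (1 + (\<Sum>n\<le>Suc N. norm (\<beta> n)))"
  have K0: "K \<ge> 0" unfolding K_def by (intro add_nonneg_nonneg sum_nonneg) auto
  show ?thesis
  proof (intro exI[of _ "2 * K * C"] ballI impI)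
    fix h assume h: "h \<in> acute_cone \<delta>" "h \<noteq> 0" "norm h \<le> 1"
    define s where "s = norm h"
    have s: "0 < s" "s \<le> 1" using h by (auto simp: s_def)
    define err where "err = (\<lambda>m. h * g ((of_nat m + of_real \<alpha>) * h) -
        (\<Sum>n\<le>Suc N. \<beta> n * h ^ n * (p n (of_nat (Suc m) * h) - p n (of_nat m * h))))"
    have err: "norm (err m) \<le> K * C * s ^ (N + 2) * (1 / (1 + real m * s)\<^sup>2)" for m
    proof -
      have seg: "x \<in> acute_cone \<delta> \<and> real m * s \<le> norm x"
        if "x \<in> closed_segment (of_nat m * h) (of_nat m * h + h)" for x
      proof -
        from that obtain u where u: "0 \<le> u" "x = of_nat m * h + of_real u * h"
          by (auto simp: in_segment scaleR_conv_of_real algebra_simps)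
        hence x: "x = of_real (real m + u) * h" by (simp add: algebra_simps)
        have "norm x = (real m + u) * s"
          unfolding x norm_mult norm_of_real using u by (simp add: s_def)
        moreover have "real m * s \<le> (real m + u) * s" using u s by (intro mult_right_mono) auto
        ultimately show ?thesis using u h acute_cone_cmult[OF h(1), of "real m + u"] by (simp add: x)
      qed
      have "norm (h * p 1 (of_nat m * h + of_real \<alpha> * h) -
              (\<Sum>n\<le>Suc N. \<beta> n * h ^ n * (p n (of_nat m * h + h) - p n (of_nat m * h))))
            \<le> (1 + (\<Sum>n\<le>Suc N. norm (\<beta> n))) * (C / (1 + real m * s)\<^sup>2) * norm h ^ (N + 2)"
        unfolding \<beta>_def
      proof (rule euler_maclaurin_step)
        fix x assume x: "x \<in> closed_segment (of_nat m * h) (of_nat m * h + h)"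
        show "(p n has_field_derivative p (Suc n) x) (at x)" for n
          using seg[OF x] acute_cone_subset_region[OF \<delta>] by (intro p_deriv) auto
        have "norm (p (Suc (Suc N)) x) \<le> C / (1 + norm x)\<^sup>2"
          using C[of x] seg[OF x] by (simp add: p_def)
        also have "\<dots> \<le> C / (1 + real m * s)\<^sup>2"
          using C0 s seg[OF x]
          by (intro divide_left_mono power_mono mult_pos_pos zero_less_power add_pos_nonneg add_left_mono) auto
        finally show "norm (p (Suc (Suc N)) x) \<le> C / (1 + real m * s)\<^sup>2" .
      qed (use \<alpha> in auto)
      also have "h * p 1 (of_nat m * h + of_real \<alpha> * h) -
              (\<Sum>n\<le>Suc N. \<beta> n * h ^ n * (p n (of_nat m * h + h) - p n (of_nat m * h))) = err m"
        by (simp add: err_def p_def algebra_simps del: sum.atMost_Suc)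
      finally show ?thesis by (simp add: K_def s_def)
    qed
    define l where "l = (\<lambda>n. if n = (0::nat) then half_line_integral else (0::complex))"
    have lim: "(\<lambda>m. p n (of_nat m * h)) \<longlonglongrightarrow> l n" for n
    proof (cases n)
      case 0
      thus ?thesis using primitive_tendsto_integral_ray[OF \<delta> h(1,2)] by (simp add: p_def l_def)
    next
      case (Suc k)
      obtain D where D: "\<And>z. z \<in> acute_cone \<delta> \<Longrightarrow> norm ((deriv ^^ k) g z) \<le> D / (1 + norm z)\<^sup>2"
        using higher_deriv_decay[OF \<delta>] by blast
      have "norm (p n (of_nat m * h)) \<le> D / (1 + real m * s)\<^sup>2" for m
        using D[OF acute_cone_cmult[OF h(1), of "real m"]] by (simp add: Suc p_def norm_mult s_def)
      hence "eventually (\<lambda>m. norm (p n (of_nat m * h)) \<le> D * (1 / (1 + real m * s)\<^sup>2)) sequentially"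
        by simp
      moreover have "(\<lambda>m. D * (1 / (1 + real m * s)\<^sup>2)) \<longlonglongrightarrow> 0"
        by (intro tendsto_mult_right_zero summable_LIMSEQ_zero sum_inverse_square_le s)
      ultimately have "(\<lambda>m. p n (of_nat m * h)) \<longlonglongrightarrow> 0"
        by (rule Lim_null_comparison)
      thus ?thesis by (simp add: l_def Suc)
    qed
    have "(\<lambda>m. \<Sum>n\<le>Suc N. \<beta> n * h ^ n * (p n (of_nat (Suc m) * h) - p n (of_nat m * h)))
            sums (\<Sum>n\<le>Suc N. \<beta> n * h ^ n * (l n - p n (of_nat 0 * h)))"
    proof (intro sums_sum sums_mult)
      fix n
      show "(\<lambda>m. p n (of_nat (Suc m) * h) - p n (of_nat m * h)) sums (l n - p n (of_nat 0 * h))"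
        by (rule telescope_sums[OF lim])
    qed
    moreover have "(\<Sum>n\<le>Suc N. \<beta> n * h ^ n * (l n - p n (of_nat 0 * h))) =
        half_line_integral - (\<Sum>n\<le>N. \<beta> (Suc n) * (deriv ^^ n) g 0 * h ^ Suc n)"
      by (subst sum.atMost_Suc_shift)
         (simp add: l_def p_def \<beta>_def bernoulli_fps_nth_0 primitive_0 sum_negf mult_ac)
    moreover have "(\<lambda>m. h * g ((of_nat m + of_real \<alpha>) * h)) sums (h * (\<Sum>m. g ((of_nat m + of_real \<alpha>) * h)))"
      using summable_shifted[OF \<delta> h(1,2) \<alpha>(1)] by (intro sums_mult summable_sums)
    ultimately have sums: "err sums (h * (\<Sum>m. g ((of_nat m + of_real \<alpha>) * h)) -
         (half_line_integral - (\<Sum>n\<le>N. \<beta> (Suc n) * (deriv ^^ n) g 0 * h ^ Suc n)))"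
      unfolding err_def by (intro sums_diff) simp_all
    have sm: "summable (\<lambda>m. K * C * s ^ (N + 2) * (1 / (1 + real m * s)\<^sup>2))"
      by (intro summable_mult sum_inverse_square_le s)
    have "norm (suminf err) \<le> (\<Sum>m. K * C * s ^ (N + 2) * (1 / (1 + real m * s)\<^sup>2))"
      by (intro norm_suminf_le err sm)
    also have "\<dots> = K * C * s ^ (N + 2) * (\<Sum>m. 1 / (1 + real m * s)\<^sup>2)"
      by (intro suminf_mult sum_inverse_square_le s)
    also have "\<dots> \<le> K * C * s ^ (N + 2) * (2 / s)"
      using K0 C0 s by (intro mult_left_mono sum_inverse_square_le) auto
    also have "\<dots> = 2 * K * C * s ^ Suc N" using s by simp
    finally show "norm (h * (\<Sum>m. g ((of_nat m + of_real \<alpha>) * h)) -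
                 (half_line_integral -
                   (\<Sum>n\<le>N. fps_nth (bernoulli_fps \<alpha>) (Suc n) * (deriv ^^ n) g 0 * h ^ Suc n)))
           \<le> 2 * K * C * norm h ^ Suc N"
      unfolding sums_unique[OF sums, symmetric] by (simp add: \<beta>_def s_def)
  qed
qed

end

section \<open>The exponential sum of the model pole\<close>

text \<open>
  This is \<open>exp (- \<alpha> * h) * \<Phi> (exp (- h), 1, \<alpha>)\<close> with the Lerch transcendent \<open>\<Phi>\<close>.  Dividing by \<open>h\<close> gives the sum
  of \<open>exp (- z) / z\<close> over the points \<open>z = (m + \<alpha>) * h\<close>.
\<close>

definition exp_sum :: "real \<Rightarrow> complex \<Rightarrow> complex" where
  "exp_sum \<alpha> h = (\<Sum>m. exp (- (of_nat m + of_real \<alpha>) * h) / (of_nat m + of_real \<alpha>))"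

lemma summable_exp_sum_coeffs:
  assumes \<alpha>: "0 < \<alpha>" and q: "norm q < 1"
  shows "summable (\<lambda>m. 1 / (of_nat m + complex_of_real \<alpha>) * q ^ m)"
proof (rule summable_comparison_test')
  show "summable (\<lambda>m. 1 / \<alpha> * norm q ^ m)" using q by (intro summable_mult summable_geometric) auto
  fix m :: nat
  have "of_nat m + complex_of_real \<alpha> = of_real (real m + \<alpha>)" by simp
  hence "norm (1 / (of_nat m + complex_of_real \<alpha>)) = 1 / (real m + \<alpha>)"
    using \<alpha> by (simp only: norm_divide norm_of_real) simp
  also have "\<dots> \<le> 1 / \<alpha>" using \<alpha> by (intro divide_left_mono) auto
  finally show "norm (1 / (of_nat m + complex_of_real \<alpha>) * q ^ m) \<le> 1 / \<alpha> * norm q ^ m"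
    unfolding norm_mult norm_power by (intro mult_right_mono) auto
qed

lemma exp_sum_power_series:
  assumes \<alpha>: "0 < \<alpha>" and h: "0 < Re h"
  shows "(\<lambda>m. exp (- (of_nat m + of_real \<alpha>) * h) / (of_nat m + of_real \<alpha>)) sums
           (exp (- of_real \<alpha> * h) * (\<Sum>m. 1 / (of_nat m + of_real \<alpha>) * exp (- h) ^ m))"
proof -
  have "norm (exp (- h)) < 1" using h by simp
  from sums_mult[OF summable_sums[OF summable_exp_sum_coeffs[OF \<alpha> this]], of "exp (- of_real \<alpha> * h)"]
  show ?thesis by (simp add: exp_of_nat_mult[symmetric] exp_add[symmetric] algebra_simps)
qed

text \<open>
  Multiplying the \<open>m\<close>-th term by \<open>- (m + \<alpha>)\<close> leaves a geometric series.  Writing the sum as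
  \<open>exp (- \<alpha> * h)\<close> times a power series in \<open>q = exp (- h)\<close> reduces this to termwise differentiation of a
  power series.
\<close>

lemma exp_sum_has_field_derivative:
  assumes \<alpha>: "0 < \<alpha>" and h: "0 < Re h"
  shows "(exp_sum \<alpha> has_field_derivative - exp (- of_real \<alpha> * h) / (1 - exp (- h))) (at h)"
proof -
  define a where "a = (\<lambda>m::nat. 1 / (of_nat m + complex_of_real \<alpha>))"
  define T where "T = (\<lambda>q. \<Sum>m. a m * q ^ m)"
  define q where "q = exp (- h)"
  define D where "D = (\<Sum>n. diffs a n * q ^ n)"
  have q: "norm q < 1" using h by (simp add: q_def)
  have sm: "summable (\<lambda>m. a m * z ^ m)" if "norm z < 1" for z
    using summable_exp_sum_coeffs[OF \<alpha> that] by (simp add: a_def)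
  have T: "(T has_field_derivative D) (at q)"
    unfolding T_def D_def by (rule termdiffs_strong'[OF sm q])
  have a: "(of_real \<alpha> + of_nat n) * a n = 1" for n
  proof -
    have "complex_of_real \<alpha> + of_nat n = of_real (\<alpha> + real n)" by simp
    also have "\<dots> \<noteq> 0" using \<alpha> by (simp only: of_real_eq_0_iff)
    finally show ?thesis by (simp add: a_def add.commute)
  qed
  have "summable (\<lambda>n. diffs a n * q ^ n)"
    by (rule termdiff_converges[OF q sm])
  from sums_add[OF sums_mult[OF summable_sums[OF sm[OF q]], of "of_real \<alpha>"] sums_mult[OF diffs_equiv[OF this], of q]]
  have "(\<lambda>n. of_real \<alpha> * (a n * q ^ n) + q * (of_nat n * a n * q ^ (n - Suc 0))) sums (of_real \<alpha> * T q + q * D)"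
    by (simp only: T_def D_def)
  also have "(\<lambda>n. of_real \<alpha> * (a n * q ^ n) + q * (of_nat n * a n * q ^ (n - Suc 0))) = (\<lambda>n. q ^ n)"
  proof
    fix n
    have "q * (of_nat n * a n * q ^ (n - Suc 0)) = of_nat n * a n * q ^ n"
      by (cases n) auto
    hence "of_real \<alpha> * (a n * q ^ n) + q * (of_nat n * a n * q ^ (n - Suc 0)) = ((of_real \<alpha> + of_nat n) * a n) * q ^ n"
      by (simp add: algebra_simps)
    thus "of_real \<alpha> * (a n * q ^ n) + q * (of_nat n * a n * q ^ (n - Suc 0)) = q ^ n" by (simp add: a)
  qed
  finally have TD: "of_real \<alpha> * T q + q * D = 1 / (1 - q)"
    using geometric_sums[OF q] by (rule sums_unique2)
  have "((\<lambda>h. exp (- of_real \<alpha> * h) * T (exp (- h))) has_field_derivative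
          - exp (- of_real \<alpha> * h) * (of_real \<alpha> * T q + q * D)) (at h)"
    by (rule derivative_eq_intros DERIV_chain2[where f = T and g = "\<lambda>h. exp (- h)"] T[unfolded q_def] refl)+
       (simp add: q_def algebra_simps)
  hence "((\<lambda>h. exp (- of_real \<alpha> * h) * T (exp (- h))) has_field_derivative
          - exp (- of_real \<alpha> * h) / (1 - exp (- h))) (at h)"
    unfolding TD by (simp add: q_def)
  thus ?thesis
  proof (rule has_field_derivative_transform_within_open)
    show "open {z. Re z > 0}" by (rule open_halfspace_Re_gt)
    show "exp (- of_real \<alpha> * z) * T (exp (- z)) = exp_sum \<alpha> z" if "z \<in> {z. Re z > 0}" for z
      using sums_unique[OF exp_sum_power_series[OF \<alpha>, of z]] that by (simp add: exp_sum_def T_def a_def)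
  qed (use h in auto)
qed

text \<open>
  Compare the coefficients \<open>1 / (m + \<alpha>)\<close> with \<open>1 / (m + 1)\<close>.  The latter sum to the logarithm
  \<open>- ln (1 - q) / q\<close> with \<open>q = exp (- x)\<close>, which cancels \<open>ln x\<close> in the limit.  The differences are
  summable, so their power series is continuous up to \<open>q = 1\<close>, where its value is the digamma series.
\<close>

lemma exp_sum_plus_ln_tendsto:
  assumes \<alpha>: "0 < \<alpha>" "\<alpha> \<le> 1"
  shows "((\<lambda>x::real. exp_sum \<alpha> (of_real x) + Ln (of_real x)) \<longlongrightarrow> of_real (K_const \<alpha>)) (at_right 0)"
proof -
  define d where "d = (\<lambda>m::nat. 1 / (real m + \<alpha>) - 1 / real (Suc m))"
  have nz: "\<alpha> \<notin> \<int>\<^sub>\<le>\<^sub>0" using \<alpha> by (auto elim!: nonpos_Ints_cases)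
  have sd: "summable (\<lambda>n. inverse (real (Suc n)) - inverse (\<alpha> + real n))"
    using summable_Digamma[of \<alpha>] \<alpha> by simp
  have d_eq: "d = (\<lambda>n. - (inverse (real (Suc n)) - inverse (\<alpha> + real n)))"
    by (simp add: d_def fun_eq_iff inverse_eq_divide add.commute)
  have d_summable: "summable d" unfolding d_eq by (intro summable_minus sd)
  have "deriv Gamma \<alpha> = Gamma \<alpha> * Digamma \<alpha>"
    by (intro DERIV_imp_deriv has_field_derivative_Gamma nz)
  hence "K_const \<alpha> = - euler_mascheroni - Digamma \<alpha>"
    using nz by (simp add: K_const_def Gamma_eq_zero_iff)
  also have "\<dots> = suminf d"
    unfolding d_eq suminf_minus[OF sd] Digamma_def by simp
  finally have K: "K_const \<alpha> = suminf d" .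
  have d_nonneg: "d m \<ge> 0" for m
    using \<alpha> unfolding d_def by (auto intro!: divide_left_mono mult_pos_pos)
  have cont: "continuous_on {0..1} (\<lambda>q. \<Sum>m. d m * q ^ m)"
  proof (rule uniform_limit_theorem)
    show "uniform_limit {0..1} (\<lambda>n q. \<Sum>m<n. d m * q ^ m) (\<lambda>q. \<Sum>m. d m * q ^ m) sequentially"
    proof (rule Weierstrass_m_test[OF _ d_summable])
      fix n and q :: real assume "q \<in> {0..1}"
      thus "norm (d n * q ^ n) \<le> d n"
        using d_nonneg[of n] by (auto simp: abs_mult intro!: mult_right_le_one_le power_le_one)
    qed
  qed (auto intro!: always_eventually continuous_intros)
  have ev: "exp_sum \<alpha> (of_real x) + Ln (of_real x) = of_real (
      (- exp (- \<alpha> * x) * exp x * ln (1 - exp (- x)) + ln x) + exp (- \<alpha> * x) * (\<Sum>m. d m * exp (- x) ^ m))"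
    if x: "x > 0" for x :: real
  proof -
    define q where "q = exp (- x)"
    have q: "0 < q" "q < 1" using x by (auto simp: q_def)
    have "(\<lambda>n. - ((- (- of_real q)) ^ n) / of_nat n) sums ln (1 + (- of_real q :: complex))"
      using q by (intro Ln_series') simp
    also have "1 + (- of_real q :: complex) = of_real (1 - q)" by simp
    also have "ln \<dots> = complex_of_real (ln (1 - q))" using q by (intro Ln_of_real) auto
    also have "(\<lambda>n. - ((- (- of_real q)) ^ n) / of_nat n) = (\<lambda>n. complex_of_real (- (q ^ n) / real n))"
      by simp
    finally have "(\<lambda>n. - (q ^ n) / real n) sums ln (1 - q)" unfolding sums_of_real_iff .
    hence "(\<lambda>n. - (q ^ Suc n) / real (Suc n)) sums ln (1 - q)"
      by (subst sums_Suc_iff) simp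
    hence "(\<lambda>n. - exp x * (- (q ^ Suc n) / real (Suc n))) sums (- exp x * ln (1 - q))"
      by (rule sums_mult)
    moreover have "- exp x * (- (q ^ Suc n) / real (Suc n)) = 1 / real (Suc n) * q ^ n" for n
    proof -
      have "- exp x * (- (q ^ Suc n) / real (Suc n)) = (exp x * q) * q ^ n / real (Suc n)" by simp
      also have "exp x * q = 1" by (simp add: q_def exp_minus)
      finally show ?thesis by simp
    qed
    ultimately have "(\<lambda>n. 1 / real (Suc n) * q ^ n) sums (- exp x * ln (1 - q))"
      by (simp only:)
    moreover have "summable (\<lambda>m. d m * q ^ m)"
      using q d_nonneg
      by (intro summable_comparison_test'[OF d_summable, of 0])
         (auto simp: abs_mult intro!: mult_right_le_one_le power_le_one)
    ultimately have "(\<lambda>n. 1 / real (Suc n) * q ^ n + d n * q ^ n) sums (- exp x * ln (1 - q) + (\<Sum>m. d m * q ^ m))"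
      by (intro sums_add summable_sums)
    also have "(\<lambda>n. 1 / real (Suc n) * q ^ n + d n * q ^ n) = (\<lambda>n. 1 / (real n + \<alpha>) * q ^ n)"
      by (simp add: d_def fun_eq_iff algebra_simps del: of_nat_Suc)
    finally have "(\<lambda>n. complex_of_real (1 / (real n + \<alpha>) * q ^ n)) sums of_real (- exp x * ln (1 - q) + (\<Sum>m. d m * q ^ m))"
      by (subst sums_of_real_iff)
    hence "(\<Sum>n. 1 / (of_nat n + of_real \<alpha>) * exp (- complex_of_real x) ^ n) =
             of_real (- exp x * ln (1 - q) + (\<Sum>m. d m * q ^ m))"
      by (simp add: sums_iff q_def flip: exp_of_real)
    hence "exp_sum \<alpha> (of_real x) = exp (- of_real \<alpha> * of_real x) * of_real (- exp x * ln (1 - q) + (\<Sum>m. d m * q ^ m))"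
      using sums_unique[OF exp_sum_power_series[OF \<alpha>(1), of "of_real x"]] x by (simp add: exp_sum_def)
    moreover have "exp (- complex_of_real \<alpha> * of_real x) = of_real (exp (- \<alpha> * x))" by (simp flip: exp_of_real)
    moreover have "Ln (complex_of_real x) = of_real (ln x)" using x by (rule Ln_of_real)
    ultimately have "exp_sum \<alpha> (of_real x) + Ln (of_real x) =
       of_real (exp (- \<alpha> * x) * (- exp x * ln (1 - q) + (\<Sum>m. d m * q ^ m)) + ln x)"
      by simp
    thus ?thesis by (simp add: q_def algebra_simps)
  qed
  have lim1: "((\<lambda>x. - exp (- \<alpha> * x) * exp x * ln (1 - exp (- x)) + ln x) \<longlongrightarrow> 0) (at_right 0)"
    by real_asymp
  have "((\<lambda>x. \<Sum>m. d m * exp (- x) ^ m) \<longlongrightarrow> (\<Sum>m. d m * 1 ^ m)) (at_right (0::real))"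
  proof (rule continuous_on_tendsto_compose[OF cont])
    show "((\<lambda>x::real. exp (- x)) \<longlongrightarrow> 1) (at_right 0)" by real_asymp
    show "\<forall>\<^sub>F x::real in at_right 0. exp (- x) \<in> {0..1}"
      using eventually_at_right_less[of 0] by eventually_elim auto
  qed auto
  moreover have "((\<lambda>x. exp (- \<alpha> * x)) \<longlongrightarrow> 1) (at_right 0)" by real_asymp
  ultimately have "((\<lambda>x. (- exp (- \<alpha> * x) * exp x * ln (1 - exp (- x)) + ln x) + exp (- \<alpha> * x) * (\<Sum>m. d m * exp (- x) ^ m))
      \<longlongrightarrow> 0 + 1 * (\<Sum>m. d m * 1 ^ m)) (at_right 0)"
    by (intro tendsto_add tendsto_mult lim1)
  hence "((\<lambda>x. complex_of_real ((- exp (- \<alpha> * x) * exp x * ln (1 - exp (- x)) + ln x) + exp (- \<alpha> * x) * (\<Sum>m. d m * exp (- x) ^ m)))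
      \<longlongrightarrow> of_real (0 + 1 * (\<Sum>m. d m * 1 ^ m))) (at_right 0)"
    by (rule tendsto_of_real)
  moreover have "eventually (\<lambda>x::real. of_real ((- exp (- \<alpha> * x) * exp x * ln (1 - exp (- x)) + ln x) + exp (- \<alpha> * x) * (\<Sum>m. d m * exp (- x) ^ m))
        = exp_sum \<alpha> (of_real x) + Ln (of_real x)) (at_right 0)"
    using eventually_at_right_less[of 0] by eventually_elim (simp only: ev)
  ultimately show ?thesis using K by (auto dest: Lim_transform_eventually)
qed


text \<open>
  The generating function of the Bernoulli polynomials at \<open>- z\<close>.
\<close>

lemma alternating_bernoulli_fps:
  fixes \<alpha> :: real
  defines "A \<equiv> Abs_fps (\<lambda>n. (-1) ^ n * fps_nth (bernoulli_fps \<alpha>) n)"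
  shows "(\<lambda>z. if z = 0 then 1 else z * exp (- of_real \<alpha> * z) / (1 - exp (- z))) has_fps_expansion A"
proof -
  have A: "A = bernoulli_fps \<alpha> oo (- fps_X)"
    unfolding A_def fps_compose_uminus' ..
  have "A * (fps_exp (-1) - 1) = (bernoulli_fps \<alpha> * (fps_exp 1 - 1)) oo (- fps_X)"
    by (simp add: A fps_compose_mult_distrib fps_compose_sub_distrib)
  also have "\<dots> = - fps_X * fps_exp (- of_real \<alpha>)"
    by (simp add: bernoulli_fps_mult_exp fps_compose_mult_distrib)
  finally have *: "A * (1 - fps_exp (-1)) = fps_X * fps_exp (- of_real \<alpha>)"
    by (simp add: algebra_simps)
  have nz: "(1 - fps_exp (-1) :: complex fps) \<noteq> 0"
    by (auto dest!: arg_cong[where f = "\<lambda>F. fps_nth F 1"])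
  have sub: "subdegree (1 - fps_exp (-1) :: complex fps) = 1"
    by (rule subdegreeI) auto
  have sub': "subdegree (fps_X * fps_exp (- of_real \<alpha>) :: complex fps) = 1"
    by (rule subdegreeI) auto
  have "A = (fps_X * fps_exp (- of_real \<alpha>)) / (1 - fps_exp (-1))"
    unfolding *[symmetric] using nz by simp
  also have "(\<lambda>z. if z = 0 then 1 else (z * exp (- of_real \<alpha> * z)) / (1 - exp (- z))) has_fps_expansion \<dots>"
    by (intro has_fps_expansion_divide fps_expansion_intros nz) (simp_all add: sub sub')
  finally show ?thesis .
qed

text \<open>
  The function \<open>exp_sum \<alpha> + Ln\<close> has derivative \<open>1 / z - exp (- \<alpha> * z) / (1 - exp (- z))\<close>, which is
  \<open>(1 - A z) / z\<close> for the alternating Bernoulli series \<open>A\<close> and so has a power series at 0.  Its integral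
  is the asserted sum, and the constant of integration is known from the positive axis.
\<close>

theorem exp_sum_asymptotics:
  assumes \<alpha>: "0 < \<alpha>" "\<alpha> \<le> 1"
  shows "\<exists>r>0. \<exists>C. \<forall>h. 0 < Re h \<longrightarrow> norm h < r \<longrightarrow>
           norm (exp_sum \<alpha> h - (of_real (K_const \<alpha>) - Ln h -
             (\<Sum>n\<le>N. fps_nth (bernoulli_fps \<alpha>) (Suc n) * ((-1) ^ Suc n / of_nat (Suc n)) * h ^ Suc n)))
           \<le> C * norm h ^ (N + 2)"
proof -
  define A where "A = Abs_fps (\<lambda>n. (-1) ^ n * fps_nth (bernoulli_fps \<alpha>) n)"
  \<comment> \<open>The formal integral of \<open>(A - 1) / X\<close>, vanishing at 0.\<close>
  define E where "E = Abs_fps (\<lambda>n. fps_nth A n * (if n = 0 then 0 else 1 / of_nat n))"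
  have A0: "fps_nth A 0 = 1" by (simp add: A_def bernoulli_fps_nth_0)
  from alternating_bernoulli_fps[of \<alpha>] obtain r0 where r0: "r0 > 0" "fps_conv_radius A > 0"
     "\<And>z. norm z < r0 \<Longrightarrow> eval_fps A z = (if z = 0 then 1 else z * exp (- of_real \<alpha> * z) / (1 - exp (- z)))"
    unfolding has_fps_expansion_def A_def[symmetric] eventually_nhds_metric dist_norm by auto
  obtain R where R: "0 < ereal R" "ereal R < fps_conv_radius A"
    using ereal_dense2[OF r0(2)] by auto
  have "summable (\<lambda>n. fps_nth E n * of_real R ^ n)"
  proof (rule summable_comparison_test')
    show "summable (\<lambda>n. norm (fps_nth A n * of_real R ^ n))"
      using R unfolding fps_conv_radius_def by (intro abs_summable_in_conv_radius) auto
    show "norm (fps_nth E n * of_real R ^ n) \<le> norm (fps_nth A n * of_real R ^ n)" for n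
    proof -
      have "norm (if n = 0 then 0 else 1 / of_nat n :: complex) \<le> 1"
        by (auto simp: norm_divide divide_simps)
      hence "norm (fps_nth A n) * norm (if n = 0 then 0 else 1 / of_nat n :: complex) \<le> norm (fps_nth A n)"
        by (intro mult_right_le_one_le) auto
      thus ?thesis unfolding norm_mult E_def by (simp add: mult_right_mono norm_mult)
    qed
  qed
  from conv_radius_geI[OF this] R have radE: "fps_conv_radius E \<ge> ereal R"
    by (simp add: fps_conv_radius_def)
  have derivE: "fps_deriv E = fps_shift 1 A"
  proof (rule fps_ext)
    fix n
    have "1 + complex_of_nat n \<noteq> 0" using of_nat_neq_0[of n, where 'a = complex] by simp
    thus "fps_nth (fps_deriv E) n = fps_nth (fps_shift 1 A) n" by (simp add: E_def)
  qed
  define r where "r = min r0 R / 2"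
  have r: "r > 0" "r < r0" "r < R" using R r0 by (auto simp: r_def)
  have E_deriv: "(eval_fps E has_field_derivative (exp (- of_real \<alpha> * z) / (1 - exp (- z)) - 1 / z)) (at z)"
    if z: "norm z < r" "z \<noteq> 0" for z
  proof -
    have zA: "ereal (norm z) < fps_conv_radius A"
      using z r R by (metis less_ereal.simps(1) order.strict_trans)
    have zE: "ereal (norm z) < fps_conv_radius E"
      using z r radE by (metis less_ereal.simps(1) order.strict_trans order.strict_trans2)
    have zX: "ereal (norm z) < fps_conv_radius (fps_X * fps_shift 1 A)"
      using fps_conv_radius_mult[of fps_X "fps_shift 1 A"] zA
      by (simp add: order.strict_trans2)
    have "fps_X * fps_shift 1 A + 1 = A"
      by (rule fps_ext) (auto simp: A0)
    hence "eval_fps A z = eval_fps (fps_X * fps_shift 1 A + 1) z" by simp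
    also have "\<dots> = z * eval_fps (fps_shift 1 A) z + 1"
      using zA zX by (simp add: eval_fps_add eval_fps_mult)
    finally have "eval_fps (fps_shift 1 A) z = exp (- of_real \<alpha> * z) / (1 - exp (- z)) - 1 / z"
      using r0(3)[of z] z r by (simp add: field_simps)
    thus ?thesis using has_field_derivative_eval_fps[OF zE] by (simp add: derivE)
  qed
  define B where "B = ball 0 r \<inter> {z::complex. Re z > 0}"
  have "\<exists>\<kappa>. \<forall>z\<in>B. exp_sum \<alpha> z + Ln z + eval_fps E z = \<kappa>"
  proof (rule has_field_derivative_zero_constant)
    show "convex B" unfolding B_def by (intro convex_Int convex_ball convex_halfspace_Re_gt)
    fix z assume z: "z \<in> B"
    hence z': "Re z > 0" "z \<noteq> 0" "norm z < r" "z \<notin> \<real>\<^sub>\<le>\<^sub>0" by (auto simp: B_def complex_nonpos_Reals_iff)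
    have "((\<lambda>z. exp_sum \<alpha> z + Ln z + eval_fps E z) has_field_derivative
            (- exp (- of_real \<alpha> * z) / (1 - exp (- z)) + inverse z +
              (exp (- of_real \<alpha> * z) / (1 - exp (- z)) - 1 / z))) (at z)"
      by (intro DERIV_add exp_sum_has_field_derivative \<alpha> z' E_deriv has_field_derivative_Ln)
    thus "((\<lambda>z. exp_sum \<alpha> z + Ln z + eval_fps E z) has_field_derivative 0) (at z within B)"
      by (simp add: inverse_eq_divide has_field_derivative_at_within)
  qed
  then obtain \<kappa> where \<kappa>: "\<And>z. z \<in> B \<Longrightarrow> exp_sum \<alpha> z + Ln z + eval_fps E z = \<kappa>" by blast
  have "\<kappa> = of_real (K_const \<alpha>)"
  proof (rule tendsto_unique)
    have "ereal (norm (0::complex)) < fps_conv_radius E"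
      using order.strict_trans2[OF R(1) radE] by (simp add: zero_ereal_def)
    hence "isCont (eval_fps E) 0"
      by (rule DERIV_isCont[OF has_field_derivative_eval_fps])
    moreover have "eval_fps E 0 = 0" by (simp add: eval_fps_at_0 E_def)
    ultimately have "((\<lambda>x::real. eval_fps E (of_real x)) \<longlongrightarrow> 0) (at_right 0)"
      by (intro isCont_tendsto_compose[of 0 "eval_fps E", THEN tendsto_eq_rhs]) (auto intro!: tendsto_eq_intros)
    from tendsto_add[OF exp_sum_plus_ln_tendsto[OF \<alpha>] this]
    show "((\<lambda>x::real. exp_sum \<alpha> (of_real x) + Ln (of_real x) + eval_fps E (of_real x)) \<longlongrightarrow> of_real (K_const \<alpha>)) (at_right 0)"
      by simp
    have "eventually (\<lambda>x::real. x \<in> {0<..<r}) (at_right 0)"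
      using r by (intro eventually_at_right_real)
    hence "eventually (\<lambda>x::real. \<kappa> = exp_sum \<alpha> (of_real x) + Ln (of_real x) + eval_fps E (of_real x)) (at_right 0)"
      by eventually_elim (subst \<kappa>, auto simp: B_def)
    thus "((\<lambda>x::real. exp_sum \<alpha> (of_real x) + Ln (of_real x) + eval_fps E (of_real x)) \<longlongrightarrow> \<kappa>) (at_right 0)"
      by (rule Lim_transform_eventually[OF tendsto_const])
  qed auto
  note \<kappa> = \<kappa>[unfolded this]
  define G where "G = fps_shift (N + 2) E"
  have radG: "fps_conv_radius G \<ge> ereal R" using radE by (simp add: G_def)
  have "cball 0 r \<subseteq> eball (0::complex) (fps_conv_radius G)"
  proof
    fix z :: complex assume "z \<in> cball 0 r"
    hence "ereal (norm z) < ereal R" using r by simp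
    also note radG
    finally show "z \<in> eball 0 (fps_conv_radius G)" by simp
  qed
  hence "continuous_on (cball 0 r) (eval_fps G)"
    by (rule continuous_on_subset[OF continuous_on_eval_fps])
  hence "bounded (eval_fps G ` cball 0 r)"
    by (intro compact_imp_bounded compact_continuous_image compact_cball)
  then obtain C where C: "\<And>z. z \<in> cball 0 r \<Longrightarrow> norm (eval_fps G z) \<le> C"
    unfolding bounded_iff by blast
  show ?thesis
  proof (rule exI[of _ r], rule conjI[OF r(1)], rule exI[of _ C], intro allI impI)
    fix h :: complex assume h: "0 < Re h" "norm h < r"
    have hE: "ereal (norm h) < fps_conv_radius E"
      using h r radE by (metis less_ereal.simps(1) order.strict_trans order.strict_trans2)
    have "(\<lambda>n. fps_nth E n * h ^ n) sums eval_fps E h"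
      using hE by (rule sums_eval_fps)
    from sums_split_initial_segment[OF this, of "N + 2"]
    have "(\<lambda>n. h ^ (N + 2) * (fps_nth G n * h ^ n)) sums (eval_fps E h - (\<Sum>i<N+2. fps_nth E i * h ^ i))"
      by (simp add: G_def power_add mult_ac)
    moreover have "(\<lambda>n. h ^ (N + 2) * (fps_nth G n * h ^ n)) sums (h ^ (N + 2) * eval_fps G h)"
      using hE by (intro sums_mult sums_eval_fps) (simp add: G_def)
    ultimately have "eval_fps E h - (\<Sum>i<N+2. fps_nth E i * h ^ i) = h ^ (N + 2) * eval_fps G h"
      by (rule sums_unique2)
    also have "(\<Sum>i<N+2. fps_nth E i * h ^ i) = (\<Sum>i\<le>Suc N. fps_nth E i * h ^ i)"
      by (intro sum.cong) auto
    also have "\<dots> = (\<Sum>n\<le>N. fps_nth (bernoulli_fps \<alpha>) (Suc n) * ((-1) ^ Suc n / of_nat (Suc n)) * h ^ Suc n)"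
      by (subst sum.atMost_Suc_shift) (simp add: E_def A_def mult_ac)
    finally have "exp_sum \<alpha> h - (of_real (K_const \<alpha>) - Ln h -
             (\<Sum>n\<le>N. fps_nth (bernoulli_fps \<alpha>) (Suc n) * ((-1) ^ Suc n / of_nat (Suc n)) * h ^ Suc n))
             = - (h ^ (N + 2) * eval_fps G h)"
      using \<kappa>[of h] h by (simp add: B_def algebra_simps)
    also have "norm \<dots> = norm (eval_fps G h) * norm h ^ (N + 2)"
      by (simp add: norm_mult norm_power)
    also have "\<dots> \<le> C * norm h ^ (N + 2)"
      using h by (intro mult_right_mono C) auto
    finally show "norm (exp_sum \<alpha> h - (of_real (K_const \<alpha>) - Ln h -
             (\<Sum>n\<le>N. fps_nth (bernoulli_fps \<alpha>) (Suc n) * ((-1) ^ Suc n / of_nat (Suc n)) * h ^ Suc n)))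
           \<le> C * norm h ^ (N + 2)" .
  qed
qed

section \<open>Removing the pole\<close>

text \<open>
  The function and its power series agree where both are defined near 0, so they glue together.
\<close>

lemma extend_holomorphic_by_power_series:
  assumes q: "q analytic_on right_half_plane" and G: "has_power_series_at_0 q G"
  obtains \<rho> q' where "0 < \<rho>" "q' holomorphic_on (right_half_plane \<union> ball 0 \<rho>)"
    "\<And>z. z \<in> right_half_plane \<Longrightarrow> q' z = q z"
proof -
  obtain R where R: "0 < ereal R" "ereal R < fps_conv_radius G"
    using ereal_dense2[of 0 "fps_conv_radius G"] G by (auto simp: has_power_series_at_0_def)
  obtain d where d: "d > 0" "\<And>z. z \<in> right_half_plane \<Longrightarrow> z \<noteq> 0 \<Longrightarrow> norm z < d \<Longrightarrow> q z = eval_fps G z"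
    using G unfolding has_power_series_at_0_def eventually_at by (auto simp: dist_norm)
  define \<rho> where "\<rho> = min R d"
  show ?thesis
  proof (rule that[of \<rho> "\<lambda>z. if z \<in> right_half_plane then q z else eval_fps G z"])
    show "0 < \<rho>" using R d by (simp add: \<rho>_def)
    show "(\<lambda>z. if z \<in> right_half_plane then q z else eval_fps G z) holomorphic_on (right_half_plane \<union> ball 0 \<rho>)"
    proof (rule holomorphic_on_If_Un)
      show "q holomorphic_on right_half_plane" using q by (rule analytic_imp_holomorphic)
      have "ball (0::complex) \<rho> \<subseteq> eball 0 (fps_conv_radius G)"
      proof
        fix z :: complex assume "z \<in> ball 0 \<rho>"
        hence "ereal (norm z) < ereal R" by (simp add: \<rho>_def)
        also note R(2)
        finally show "z \<in> eball 0 (fps_conv_radius G)" by simp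
      qed
      thus "eval_fps G holomorphic_on ball 0 \<rho>" by (rule holomorphic_on_eval_fps)
      show "open right_half_plane" unfolding right_half_plane_def by (rule open_halfspace_Re_gt)
      show "q z = eval_fps G z" if "z \<in> right_half_plane" "z \<in> ball 0 \<rho>" for z
        using that by (intro d) (auto simp: \<rho>_def right_half_plane_def)
    qed auto
  qed auto
qed

lemma rapidly_decreasing_quadratic:
  assumes "rapidly_decreasing q"
  shows "\<exists>R. \<forall>z\<in>right_half_plane. R \<le> norm z \<longrightarrow> (norm z)\<^sup>2 * norm (q z) \<le> 1"
proof -
  have "\<forall>m n :: nat. ((\<lambda>z. z ^ m * (deriv ^^ n) q z) \<longlongrightarrow> 0) (inf at_infinity (principal right_half_plane))"
    using assms by (simp add: rapidly_decreasing_def)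
  from this[rule_format, of 2 0]
  have "((\<lambda>z. z ^ 2 * q z) \<longlongrightarrow> 0) (inf at_infinity (principal right_half_plane))" by simp
  hence "eventually (\<lambda>z. norm (z ^ 2 * q z) < 1) (inf at_infinity (principal right_half_plane))"
    using order_tendstoD(2)[OF tendsto_norm_zero zero_less_one] by blast
  thus ?thesis unfolding eventually_inf_principal eventually_at_infinity norm_mult norm_power
    by (meson less_imp_le)
qed

lemma continuous_on_acute_cone:
  assumes "g holomorphic_on (right_half_plane \<union> ball 0 \<rho>)" "0 < \<rho>" "0 < \<delta>"
  shows "continuous_on (acute_cone \<delta>) g"
proof (rule continuous_on_subset[OF holomorphic_on_imp_continuous_on[OF assms(1)]])
  show "acute_cone \<delta> \<subseteq> right_half_plane \<union> ball 0 \<rho>"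
    using acute_cone_subset[OF assms(3)] assms(2) by auto
qed

text \<open>
  If \<open>f - c * exp (- z) / z\<close> is itself rapidly decreasing, only the extension across 0 is at issue.  If \<open>f\<close> is,
  then \<open>f - c / z\<close> extends across 0, and the remaining difference \<open>c * (1 - exp (- z)) / z\<close> of the two poles
  is entire up to a removable singularity.  The decay then comes from that of \<open>f\<close> and of \<open>exp (- z)\<close>,
  the latter because \<open>Re z \<ge> \<delta> * norm z\<close> in a cone.
\<close>

lemma C_analytic_up_to_pole_imp_cone_decaying:
  assumes f: "C_analytic_up_to_pole f c"
  obtains g \<rho> where "cone_decaying g \<rho>"
    "\<And>z. z \<in> right_half_plane \<Longrightarrow> g z = f z - c * exp (- z) / z"
  using f unfolding C_analytic_up_to_pole_def
proof (elim disjE conjE exE)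
  assume "C_analytic (\<lambda>z. f z - c * exp (- z) / z)"
  then obtain G where q: "rapidly_decreasing (\<lambda>z. f z - c * exp (- z) / z)"
     "has_power_series_at_0 (\<lambda>z. f z - c * exp (- z) / z) G" by (auto simp: C_analytic_def)
  obtain \<rho> g where g: "0 < \<rho>" "g holomorphic_on (right_half_plane \<union> ball 0 \<rho>)"
    "\<And>z. z \<in> right_half_plane \<Longrightarrow> g z = f z - c * exp (- z) / z"
    using extend_holomorphic_by_power_series[OF _ q(2)] q(1) by (auto simp: rapidly_decreasing_def)
  obtain R where R: "\<And>z. z \<in> right_half_plane \<Longrightarrow> R \<le> norm z \<Longrightarrow> (norm z)\<^sup>2 * norm (f z - c * exp (- z) / z) \<le> 1"
    using rapidly_decreasing_quadratic[OF q(1)] by blast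
  have "cone_decaying g \<rho>"
  proof
    fix \<delta> :: real assume \<delta>: "0 < \<delta>"
    show "\<exists>C. \<forall>z\<in>acute_cone \<delta>. norm (g z) \<le> C / (1 + norm z)\<^sup>2"
    proof (rule cone_decay_of_quadratic[where R = "max 1 R"])
      show "continuous_on (acute_cone \<delta>) g" by (rule continuous_on_acute_cone[OF g(2,1) \<delta>])
      fix z assume z: "z \<in> acute_cone \<delta>" "max 1 R \<le> norm z"
      hence "z \<noteq> 0" by auto
      hence "z \<in> right_half_plane" using z acute_cone_subset[OF \<delta>] by auto
      thus "(norm z)\<^sup>2 * norm (g z) \<le> 1" using R[of z] z g(3)[of z] by simp
    qed
  qed (use g in auto)
  thus thesis using g(3) by (rule that)
next
  fix G assume f: "rapidly_decreasing f" and G: "has_power_series_at_0 (\<lambda>z. f z - c / z) G"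
  have ana: "(\<lambda>z. f z - c / z) analytic_on right_half_plane"
    using f by (intro analytic_intros) (auto simp: rapidly_decreasing_def right_half_plane_def)
  obtain \<rho> g0 where g0: "0 < \<rho>" "g0 holomorphic_on (right_half_plane \<union> ball 0 \<rho>)"
    "\<And>z. z \<in> right_half_plane \<Longrightarrow> g0 z = f z - c / z"
    using extend_holomorphic_by_power_series[OF ana G] by blast
  \<comment> \<open>The function \<open>(1 - exp (- z)) / z\<close>, in the form of a difference quotient of \<open>- exp (- z)\<close> at 0.\<close>
  define k where "k = (\<lambda>z::complex. if z = 0 then deriv (\<lambda>z. - exp (- z)) 0 else (- exp (- z) - - exp (- 0)) / (z - 0))"
  have k: "k holomorphic_on UNIV"
    unfolding k_def by (rule pole_lemma_open) (auto intro!: holomorphic_intros)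
  define g where "g = (\<lambda>z. g0 z + c * k z)"
  have g_hol: "g holomorphic_on (right_half_plane \<union> ball 0 \<rho>)"
    unfolding g_def by (intro holomorphic_intros g0 holomorphic_on_subset[OF k]) auto
  have g_eq: "g z = f z - c * exp (- z) / z" if "z \<in> right_half_plane" for z
    using that g0(3)[OF that] by (auto simp: g_def k_def right_half_plane_def diff_divide_distrib algebra_simps)
  obtain R where R: "\<And>z. z \<in> right_half_plane \<Longrightarrow> R \<le> norm z \<Longrightarrow> (norm z)\<^sup>2 * norm (f z) \<le> 1"
    using rapidly_decreasing_quadratic[OF f] by blast
  have "cone_decaying g \<rho>"
  proof
    fix \<delta> :: real assume \<delta>: "0 < \<delta>"
    have "((\<lambda>x::real. x * exp (- (\<delta> * x))) \<longlongrightarrow> 0) at_top" using \<delta> by real_asymp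
    hence "eventually (\<lambda>x::real. x * exp (- (\<delta> * x)) < 1) at_top"
      by (rule order_tendstoD) auto
    then obtain R' where R': "\<And>x. R' \<le> x \<Longrightarrow> x * exp (- (\<delta> * x)) < 1"
      by (auto simp: eventually_at_top_linorder)
    show "\<exists>C. \<forall>z\<in>acute_cone \<delta>. norm (g z) \<le> C / (1 + norm z)\<^sup>2"
    proof (rule cone_decay_of_quadratic[where R = "max 1 (max R R')"])
      show "continuous_on (acute_cone \<delta>) g" by (rule continuous_on_acute_cone[OF g_hol g0(1) \<delta>])
      fix z assume z: "z \<in> acute_cone \<delta>" "max 1 (max R R') \<le> norm z"
      hence z0: "z \<noteq> 0" by auto
      hence rhp: "z \<in> right_half_plane" using z acute_cone_subset[OF \<delta>] by auto
      have "norm z * norm (exp (- z)) \<le> norm z * exp (- (\<delta> * norm z))"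
        using z by (intro mult_left_mono) (auto simp: acute_cone_def)
      also have "\<dots> \<le> 1" using R'[of "norm z"] z by simp
      finally have e: "norm z * norm (exp (- z)) \<le> 1" .
      have "(norm z)\<^sup>2 * norm (g z) = norm (z ^ 2 * f z - c * (z * exp (- z)))"
        unfolding g_eq[OF rhp] norm_power[symmetric] norm_mult[symmetric]
        using z0 by (simp add: power2_eq_square algebra_simps)
      also have "\<dots> \<le> (norm z)\<^sup>2 * norm (f z) + norm c * (norm z * norm (exp (- z)))"
        by (intro order_trans[OF norm_triangle_ineq4]) (simp add: norm_mult norm_power)
      also have "\<dots> \<le> 1 + norm c * 1"
        using R[OF rhp] z e by (intro add_mono mult_left_mono) auto
      finally show "(norm z)\<^sup>2 * norm (g z) \<le> 1 + norm c * 1" .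
    qed
  qed (use g0 g_hol in auto)
  thus thesis using g_eq by (rule that)
qed


section \<open>The asymptotic expansion\<close>

theorem theorem5p1:
  fixes f :: "complex \<Rightarrow> complex" and c :: complex
  assumes f: "C_analytic_up_to_pole f c"
  shows "\<exists>F :: complex fls.
    has_simple_laurent_at_0 f F \<and> fls_nth F (-1) = c \<and>
    set_integrable lborel {0<..}
      (\<lambda>x::real. f (of_real x) - c * of_real (exp (- x) / x)) \<and>
    (\<forall>(h :: real \<Rightarrow> complex) (\<phi> :: real) (t0 :: real) (\<alpha> :: real) (N :: nat).
       (\<forall>t>0. h t \<in> right_half_plane) \<longrightarrow>
       (h \<longlongrightarrow> 0) (at_right 0) \<longrightarrow>
       - pi / 2 < \<phi> \<longrightarrow> \<phi> < pi / 2 \<longrightarrow> t0 > 0 \<longrightarrow>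
       h ` {0<..<t0} \<subseteq> sector \<phi> \<longrightarrow>
       0 < \<alpha> \<longrightarrow> \<alpha> < 1 \<longrightarrow>
       (\<forall>t>0. summable (\<lambda>m. f ((of_nat m + of_real \<alpha>) * h t))) \<and>
       (\<lambda>t. (\<Sum>m. f ((of_nat m + of_real \<alpha>) * h t))
            - (- c * Ln (h t) / h t
               + (c * of_real (K_const \<alpha>)
                  + (LINT x:{0<..}|lborel. f (of_real x) - c * of_real (exp (- x) / x)))
                 * (1 / h t)
               - (\<Sum>n=0..N. of_real (bernoulli_poly (n + 1) \<alpha> / real (n + 1))
                              * fls_nth F (int n) * h t ^ n)))
         \<in> O[at_right 0](\<lambda>t. h t ^ N))"
proof -
  obtain g \<rho> where decaying: "cone_decaying g \<rho>"
    and g: "\<And>z. z \<in> right_half_plane \<Longrightarrow> g z = f z - c * exp (- z) / z"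
    using C_analytic_up_to_pole_imp_cone_decaying[OF f] by blast
  interpret cone_decaying g \<rho> by (rule decaying)
  define G where "G = fps_expansion g 0"
  have G: "g has_fps_expansion G"
    unfolding G_def by (rule has_fps_expansion_fps_expansion[OF open_region zero_in_region holomorphic_region])
  have G_nth: "fps_nth G n = (deriv ^^ n) g 0 / fact n" for n
    by (rule fps_nth_fps_expansion[OF G])
  \<comment> \<open>The series of \<open>g\<close> plus \<open>c\<close> times that of \<open>exp (- z) / z\<close>.\<close>
  define F where "F = fps_to_fls G + fls_const c * fls_shift 1 (fps_to_fls (fps_exp (-1)))"
  have F_nth: "fls_nth F (int n) = (deriv ^^ n) g 0 / fact n + c * ((-1) ^ Suc n / fact (Suc n))" for n
    by (simp add: F_def G_nth nat_add_distrib distrib_right)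
  have "(\<lambda>z. g z + c * (exp (- z) * z powi (-1))) has_laurent_expansion F"
    unfolding F_def
    by (intro laurent_expansion_intros has_laurent_expansion_fps G fps_expansion_intros)
  hence "fls_conv_radius F > 0" "eventually (\<lambda>z. eval_fls F z = g z + c * (exp (- z) * z powi (-1))) (at 0)"
    by (auto simp: has_laurent_expansion_def)
  moreover from this(2) have "eventually (\<lambda>z. f z = eval_fls F z) (at 0 within right_half_plane)"
    unfolding eventually_at_filter
    by eventually_elim (auto simp: g field_simps power_int_minus)
  ultimately have laurent: "has_simple_laurent_at_0 f F"
    unfolding has_simple_laurent_at_0_def by (auto simp: F_def)
  have residue: "fls_nth F (-1) = c" by (simp add: F_def)

  have g_real: "f (of_real x) - c * of_real (exp (- x) / x) = g (of_real x)" if "x \<in> {0<..}" for x :: real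
    using that g[of "of_real x"] by (simp add: right_half_plane_def flip: exp_of_real)
  have integrable: "set_integrable lborel {0<..} (\<lambda>x::real. f (of_real x) - c * of_real (exp (- x) / x))"
    using set_integrable_half_line by (subst set_integrable_cong[OF refl refl g_real]) auto
  have integral: "(LINT x:{0<..}|lborel. f (of_real x) - c * of_real (exp (- x) / x)) = half_line_integral"
    unfolding half_line_integral_def
    by (intro set_lebesgue_integral_cong allI impI g_real) simp_all

  \<comment> \<open>Valid on the whole half-plane, since each of its points lies in some cone.\<close>
  have sums: "(\<lambda>m. f ((of_nat m + of_real \<alpha>) * w)) sums
      ((\<Sum>m. g ((of_nat m + of_real \<alpha>) * w)) + c / w * exp_sum \<alpha> w)"
    if w: "0 < Re w" and \<alpha>: "0 < \<alpha>" for w and \<alpha> :: real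
  proof -
    obtain \<delta> where \<delta>: "0 < \<delta>" "w \<in> acute_cone \<delta>" using acute_coneI[OF w] .
    have w0: "w \<noteq> 0" using w by auto
    have "(\<lambda>m. g ((of_nat m + of_real \<alpha>) * w)) sums (\<Sum>m. g ((of_nat m + of_real \<alpha>) * w))"
      using summable_shifted[OF \<delta> w0] \<alpha> by (intro summable_sums) auto
    moreover have "(\<lambda>m. exp (- (of_nat m + of_real \<alpha>) * w) / (of_nat m + of_real \<alpha>)) sums exp_sum \<alpha> w"
      unfolding exp_sum_def using exp_sum_power_series[OF \<alpha> w] by (intro summable_sums) (rule sums_summable)
    ultimately have "(\<lambda>m. g ((of_nat m + of_real \<alpha>) * w) +
        c / w * (exp (- (of_nat m + of_real \<alpha>) * w) / (of_nat m + of_real \<alpha>))) sums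
      ((\<Sum>m. g ((of_nat m + of_real \<alpha>) * w)) + c / w * exp_sum \<alpha> w)"
      by (intro sums_add sums_mult)
    moreover have "g ((of_nat m + of_real \<alpha>) * w) +
        c / w * (exp (- (of_nat m + of_real \<alpha>) * w) / (of_nat m + of_real \<alpha>)) =
        f ((of_nat m + of_real \<alpha>) * w)" for m
    proof -
      have "0 < (real m + \<alpha>) * Re w" using w \<alpha> by (intro mult_pos_pos) auto
      hence "(of_nat m + of_real \<alpha>) * w \<in> right_half_plane"
        by (simp add: right_half_plane_def)
      from g[OF this] show ?thesis unfolding minus_mult_left[symmetric] by (simp add: mult_ac)
    qed
    ultimately show ?thesis by (simp only:)
  qed

  have bound: "\<exists>r>0. \<exists>C. \<forall>w\<in>acute_cone \<delta>. w \<noteq> 0 \<longrightarrow> norm w < r \<longrightarrow>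
      norm ((\<Sum>m. f ((of_nat m + of_real \<alpha>) * w))
            - (- c * Ln w / w + (c * of_real (K_const \<alpha>) + half_line_integral) * (1 / w)
               - (\<Sum>n=0..N. of_real (bernoulli_poly (n + 1) \<alpha> / real (n + 1)) * fls_nth F (int n) * w ^ n)))
       \<le> C * norm w ^ N"
    if \<delta>: "0 < \<delta>" and \<alpha>: "0 < \<alpha>" "\<alpha> < 1" for \<delta> \<alpha> and N :: nat
  proof -
    define \<beta> where "\<beta> = fps_nth (bernoulli_fps \<alpha>)"
    obtain C1 where C1: "\<And>w. w \<in> acute_cone \<delta> \<Longrightarrow> w \<noteq> 0 \<Longrightarrow> norm w \<le> 1 \<Longrightarrow>
        norm (w * (\<Sum>m. g ((of_nat m + of_real \<alpha>) * w)) - (half_line_integral -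
                   (\<Sum>n\<le>N. \<beta> (Suc n) * (deriv ^^ n) g 0 * w ^ Suc n))) \<le> C1 * norm w ^ Suc N"
      using shifted_sum_asymptotics[OF \<delta>, of \<alpha> N] \<alpha> unfolding \<beta>_def by auto
    obtain r C2 where r: "r > 0" and C2: "\<And>w. 0 < Re w \<Longrightarrow> norm w < r \<Longrightarrow>
        norm (exp_sum \<alpha> w - (of_real (K_const \<alpha>) - Ln w -
             (\<Sum>n\<le>N. \<beta> (Suc n) * ((-1) ^ Suc n / of_nat (Suc n)) * w ^ Suc n))) \<le> C2 * norm w ^ (N + 2)"
      using exp_sum_asymptotics[of \<alpha> N] \<alpha> unfolding \<beta>_def by auto
    show ?thesis
    proof (rule exI[of _ "min 1 r"], rule conjI, use r in simp,
           rule exI[of _ "C1 + norm c * \<bar>C2\<bar>"], intro ballI impI)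
      fix w assume w: "w \<in> acute_cone \<delta>" "w \<noteq> 0" "norm w < min 1 r"
      have Re: "0 < Re w" using w acute_cone_subset[OF \<delta>] by (auto simp: right_half_plane_def)
      \<comment> \<open>The errors of the expansions of the two parts, each multiplied by \<open>w\<close>.\<close>
      define X where "X = w * (\<Sum>m. g ((of_nat m + of_real \<alpha>) * w)) - (half_line_integral -
                   (\<Sum>n\<le>N. \<beta> (Suc n) * (deriv ^^ n) g 0 * w ^ Suc n))"
      define Y where "Y = exp_sum \<alpha> w - (of_real (K_const \<alpha>) - Ln w -
             (\<Sum>n\<le>N. \<beta> (Suc n) * ((-1) ^ Suc n / of_nat (Suc n)) * w ^ Suc n))"
      have X: "norm X \<le> C1 * norm w ^ Suc N" unfolding X_def using w by (intro C1) auto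
      have Y: "norm Y \<le> \<bar>C2\<bar> * norm w ^ Suc N"
      proof -
        have "norm Y \<le> C2 * norm w ^ (N + 2)" unfolding Y_def using w Re by (intro C2) auto
        also have "\<dots> \<le> \<bar>C2\<bar> * norm w ^ Suc N"
          using w by (intro mult_mono power_decreasing) auto
        finally show ?thesis .
      qed
      have "of_real (bernoulli_poly (n + 1) \<alpha> / real (n + 1)) * fls_nth F (int n) * w ^ n =
          (\<beta> (Suc n) * (deriv ^^ n) g 0 * w ^ Suc n +
           c * (\<beta> (Suc n) * ((-1) ^ Suc n / of_nat (Suc n)) * w ^ Suc n)) / w" for n
      proof -
        have "bernoulli_poly (n + 1) \<alpha> / real (n + 1) = bernoulli_poly (Suc n) \<alpha> / fact (Suc n) * fact n"
          by (simp del: of_nat_Suc)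
        hence "of_real (bernoulli_poly (n + 1) \<alpha> / real (n + 1)) = \<beta> (Suc n) * fact n"
          by (simp only: \<beta>_def bernoulli_fps_def fps_nth_Abs_fps of_real_mult of_real_fact)
        moreover have "\<beta> (Suc n) * fact n * fls_nth F (int n) =
           \<beta> (Suc n) * (deriv ^^ n) g 0 + c * (\<beta> (Suc n) * ((-1) ^ Suc n / of_nat (Suc n)))"
        proof -
          have "complex_of_nat (Suc n) \<noteq> 0" by (rule of_nat_neq_0)
          moreover have "fact (Suc n) = complex_of_nat (Suc n) * fact n" by (rule fact_Suc)
          ultimately have eq: "fact n * ((-1) ^ Suc n / fact (Suc n)) = ((-1) ^ Suc n / complex_of_nat (Suc n))"
            by (simp del: fact_Suc of_nat_Suc)
          have "b * fact n * (d / fact n + c * s) = b * d + c * (b * (fact n * s))" for b d s :: complex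
            by (simp add: field_simps)
          thus ?thesis unfolding F_nth eq[symmetric] .
        qed
        moreover have "(a + c * b) * w ^ n = (a * w ^ Suc n + c * (b * w ^ Suc n)) / w" for a b
          using w(2) by (simp add: field_simps)
        ultimately show ?thesis by (simp only:)
      qed
      hence "(\<Sum>n=0..N. of_real (bernoulli_poly (n + 1) \<alpha> / real (n + 1)) * fls_nth F (int n) * w ^ n) =
         ((\<Sum>n\<le>N. \<beta> (Suc n) * (deriv ^^ n) g 0 * w ^ Suc n) +
          c * (\<Sum>n\<le>N. \<beta> (Suc n) * ((-1) ^ Suc n / of_nat (Suc n)) * w ^ Suc n)) / w"
        by (simp only: sum_divide_distrib sum_distrib_left sum.distrib[symmetric] atMost_atLeast0)
      hence "(\<Sum>m. f ((of_nat m + of_real \<alpha>) * w))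
            - (- c * Ln w / w + (c * of_real (K_const \<alpha>) + half_line_integral) * (1 / w)
               - (\<Sum>n=0..N. of_real (bernoulli_poly (n + 1) \<alpha> / real (n + 1)) * fls_nth F (int n) * w ^ n))
          = (X + c * Y) / w"
        unfolding X_def Y_def sums_unique[OF sums[OF Re \<alpha>(1)], symmetric]
        using w(2) by (simp only:) (simp add: diff_divide_distrib add_divide_distrib ring_distribs del: of_nat_Suc power_Suc)
      also have "norm \<dots> \<le> (C1 * norm w ^ Suc N + norm c * (\<bar>C2\<bar> * norm w ^ Suc N)) / norm w"
        unfolding norm_divide using X Y
        by (intro divide_right_mono order_trans[OF norm_triangle_ineq] add_mono)
           (auto simp: norm_mult intro!: mult_left_mono)
      also have "\<dots> = (C1 + norm c * \<bar>C2\<bar>) * norm w ^ N"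
        using w(2) by (simp add: field_simps)
      finally show "norm ((\<Sum>m. f ((of_nat m + of_real \<alpha>) * w))
            - (- c * Ln w / w + (c * of_real (K_const \<alpha>) + half_line_integral) * (1 / w)
               - (\<Sum>n=0..N. of_real (bernoulli_poly (n + 1) \<alpha> / real (n + 1)) * fls_nth F (int n) * w ^ n)))
            \<le> (C1 + norm c * \<bar>C2\<bar>) * norm w ^ N" .
    qed
  qed

  show ?thesis
  proof (intro exI[of _ F] conjI allI impI laurent residue integrable)
    fix h :: "real \<Rightarrow> complex" and \<phi> t0 \<alpha> :: real and N :: nat
    assume h: "\<forall>t>0. h t \<in> right_half_plane" and lim: "(h \<longlongrightarrow> 0) (at_right 0)"
      and \<phi>: "\<phi> < pi / 2" and t0: "t0 > 0" and sector: "h ` {0<..<t0} \<subseteq> sector \<phi>"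
      and \<alpha>: "0 < \<alpha>" "\<alpha> < 1"
    show "summable (\<lambda>m. f ((of_nat m + of_real \<alpha>) * h t))" if "t > 0" for t
      using sums[of "h t" \<alpha>] h that \<alpha> by (auto simp: right_half_plane_def sums_iff)
    have cone: "h t \<in> acute_cone (cos \<phi>)" and cos: "0 < cos \<phi>" if "t \<in> {0<..<t0}" for t
    proof -
      have "h t \<in> sector \<phi>" "h t \<in> right_half_plane" using sector h that by auto
      thus "h t \<in> acute_cone (cos \<phi>)" "0 < cos \<phi>"
        using sector_subset_acute_cone[OF \<phi>] by auto
    qed
    \<comment> \<open>The value of \<open>h\<close> at \<open>t0 / 2\<close> shows that the punctured sector is nonempty, so that \<open>\<phi>\<close> is positive.\<close>
    have "0 < cos \<phi>" using cos[of "t0 / 2"] t0 by simp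
    from bound[OF this \<alpha>, of N] obtain r C where r: "r > 0" and
      C: "\<And>w. w \<in> acute_cone (cos \<phi>) \<Longrightarrow> w \<noteq> 0 \<Longrightarrow> norm w < r \<Longrightarrow>
       norm ((\<Sum>m. f ((of_nat m + of_real \<alpha>) * w))
            - (- c * Ln w / w + (c * of_real (K_const \<alpha>) + half_line_integral) * (1 / w)
               - (\<Sum>n=0..N. of_real (bernoulli_poly (n + 1) \<alpha> / real (n + 1)) * fls_nth F (int n) * w ^ n)))
       \<le> C * norm w ^ N" by blast
    have "eventually (\<lambda>t. norm (h t) < r) (at_right 0)"
      using order_tendstoD(2)[OF tendsto_norm_zero[OF lim] r] .
    moreover have "eventually (\<lambda>t. t \<in> {0<..<t0}) (at_right 0)"
      using t0 by (rule eventually_at_right_real)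
    ultimately have ev: "eventually (\<lambda>t. h t \<in> acute_cone (cos \<phi>) \<and> h t \<noteq> 0 \<and> norm (h t) < r) (at_right 0)"
      by eventually_elim (use cone h in \<open>auto simp: right_half_plane_def\<close>)
    show "(\<lambda>t. (\<Sum>m. f ((of_nat m + of_real \<alpha>) * h t))
            - (- c * Ln (h t) / h t
               + (c * of_real (K_const \<alpha>)
                  + (LINT x:{0<..}|lborel. f (of_real x) - c * of_real (exp (- x) / x)))
                 * (1 / h t)
               - (\<Sum>n=0..N. of_real (bernoulli_poly (n + 1) \<alpha> / real (n + 1))
                              * fls_nth F (int n) * h t ^ n)))
         \<in> O[at_right 0](\<lambda>t. h t ^ N)"
      unfolding integral norm_power
    proof (rule bigoI[where c = C])
      show "eventually (\<lambda>t. norm ((\<Sum>m. f ((of_nat m + of_real \<alpha>) * h t))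
            - (- c * Ln (h t) / h t + (c * of_real (K_const \<alpha>) + half_line_integral) * (1 / h t)
               - (\<Sum>n=0..N. of_real (bernoulli_poly (n + 1) \<alpha> / real (n + 1)) * fls_nth F (int n) * h t ^ n)))
          \<le> C * norm (h t ^ N)) (at_right 0)"
        using ev unfolding norm_power by eventually_elim (blast intro: C)
    qed
  qed
qed

end
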